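(* Let $\Delta_0,\Delta_1,\ldots,\Delta_m$ be pairwise disjoint intervals of the real line and $\sigma_k\in\mathcal M(\Delta_k)$ for $k=0,1,\ldots,m$. Then for each $\mathbf n\in\mathbb Z_+^m$ there exists an $\mathbf n$-th non-linear Fourier-Padé approximant of $(\widehat\sigma_1,\ldots,\widehat\sigma_m)$ with respect to $\sigma_0$; that is, there exist polynomials $T_{\mathbf n},S_{\mathbf n,1},\ldots,S_{\mathbf n,m}$ such that $\deg T_{\mathbf n}\le|\mathbf n|$, $T_{\mathbf n}\not\equiv0$, $\deg S_{\mathbf n,j}\le|\mathbf n|-1$ for $j=1,\ldots,m$, and $$\int\left(\widehat\sigma_j-\frac{S_{\mathbf n,j}}{T_{\mathbf n}}\right)(x)\,\ell_k(x)\,d\sigma_0(x)=0,\qquad j=1,\ldots,m,\quad k=0,\ldots,|\mathbf n|+n_j-1,$$ where $\{\ell_n\}$ is the sequence of orthonormal polynomials with respect to $\sigma_0$.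
   Context: $\mathcal M(\Delta)$ is the class of all finite (positive) Borel measures with compact support consisting of infinitely many points and contained in the interval $\Delta\subset\mathbb R$. For $\sigma\in\mathcal M(\Delta)$, $\widehat\sigma(z)=\int\frac{d\sigma(x)}{z-x}$. $\mathbb Z_+=\{0,1,2,\ldots\}$; for $\mathbf n=(n_1,\ldots,n_m)\in\mathbb Z_+^m$, $|\mathbf n|=n_1+\cdots+n_m$. Orthonormal polynomials $\ell_n$ ($\deg\ell_n=n$) are taken with positive leading coefficient. A polynomial of degree $\le-1$ is the zero polynomial. *)

theory Defs
  imports "HOL-Analysis.Analysis" "HOL-Computational_Algebra.Polynomial"
begin

definition msupport :: "real measure \<Rightarrow> real set" where
  "msupport \<sigma> = {x. \<forall>U. open U \<and> x \<in> U \<longrightarrow> emeasure \<sigma> U > 0}"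

definition borel_class :: "real set \<Rightarrow> real measure set" where
  "borel_class \<Delta> = {\<sigma>. sets \<sigma> = sets borel \<and> finite_measure \<sigma> \<and>
     compact (msupport \<sigma>) \<and> infinite (msupport \<sigma>) \<and> msupport \<sigma> \<subseteq> \<Delta>}"

text \<open>Polymorphic, so that it covers the function on the complex plane as well as
  its values on the real line; it is meaningful for z outside the support.\<close>

definition cauchy_transform ::
    "real measure \<Rightarrow> 'a::{real_normed_field, banach, second_countable_topology} \<Rightarrow> 'a" where
  "cauchy_transform \<sigma> z = (\<integral>x. 1 / (z - of_real x) \<partial>\<sigma>)"

definition orthonormal_polys :: "real measure \<Rightarrow> (nat \<Rightarrow> real poly) \<Rightarrow> bool" where
  "orthonormal_polys \<sigma> l \<longleftrightarrow>
     (\<forall>n. degree (l n) = n \<and> lead_coeff (l n) > 0) \<and>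
     (\<forall>i j. (\<integral>x. poly (l i) x * poly (l j) x \<partial>\<sigma>) = (if i = j then 1 else 0))"

text \<open>Only the values of \<sigma>, n and S at the indices 1..m matter. The disjunction
  for the degree of S j encodes degree at most N - 1, the polynomial being zero
  when N = 0. As division by zero and integrals of non-integrable functions have the value 0
  by convention, it is required explicitly that the quotients are defined almost everywhere, and
  (through the use of has_bochner_integral) that the integrals exist.\<close>

definition nonlinear_fourier_pade ::
    "nat \<Rightarrow> real measure \<Rightarrow> (nat \<Rightarrow> real poly) \<Rightarrow> (nat \<Rightarrow> real measure) \<Rightarrow> (nat \<Rightarrow> nat) \<Rightarrow>
     real poly \<Rightarrow> (nat \<Rightarrow> real poly) \<Rightarrow> bool" where
  "nonlinear_fourier_pade m \<sigma>0 l \<sigma> n T S \<longleftrightarrow>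
     (let N = (\<Sum>j=1..m. n j) in
       degree T \<le> N \<and> T \<noteq> 0 \<and>
       (\<forall>j\<in>{1..m}. S j = 0 \<or> degree (S j) < N) \<and>
       (AE x in \<sigma>0. poly T x \<noteq> 0) \<and>
       (\<forall>j\<in>{1..m}. \<forall>k < N + n j.
          has_bochner_integral \<sigma>0
            (\<lambda>x. (cauchy_transform (\<sigma> j) x - poly (S j) x / poly T x) * poly (l k) x) 0))"

end

theory Submission
  imports Defs
begin

text \<open>
  Let \<open>N\<close> be the sum of the \<open>n j\<close> and \<open>d j = N + n j\<close>. If \<open>W j\<close> is monic of degree \<open>d j\<close> with all zeros in
  the convex hull of the support of \<open>\<sigma> 0\<close>, then \<open>1 / \<bar>W j\<bar>\<close> is a positive weight on the support of \<open>\<sigma> j\<close>, and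
  the measures \<open>d(\<sigma> j) / \<bar>W j\<bar>\<close> form an Angelesco system: there is a unique monic multiple orthogonal
  polynomial \<open>T\<close> of degree \<open>N\<close>, with \<open>n j\<close> simple zeros in the hull of the support of \<open>\<sigma> j\<close>. Its
  orthogonality yields polynomials \<open>S j\<close> of degree less than \<open>N\<close> such that the Cauchy transform of \<open>\<sigma> j\<close>
  minus \<open>S j / T\<close> equals \<open>\<plusminus> W j * H j / T\<close>, where \<open>H j x\<close> is the integral of \<open>T t / (\<bar>W j t\<bar> * (x - t))\<close>
  against \<open>\<sigma> j\<close> and \<open>H j / T\<close> has constant sign on the hull of the support of \<open>\<sigma> 0\<close>. So the
  approximation condition says that \<open>W j\<close> is the monic orthogonal polynomial of degree \<open>d j\<close> for
  \<open>\<bar>H j / T\<bar> d(\<sigma> 0)\<close>. Sending \<open>W\<close> to these orthogonal polynomials is continuous, and Brouwer's theorem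
  gives a fixed point.
\<close>

subsection \<open>Brouwer's fixed point theorem for finitely many coordinates\<close>

text \<open>The number of coordinates is a term here, so the version for Euclidean spaces, whose
  dimension is fixed by a type, does not apply.\<close>

lemma finite_coordinates_convergent_subsequence:
  fixes X :: "nat \<Rightarrow> 'i \<Rightarrow> real"
  assumes "finite I" and "\<And>i. i \<in> I \<Longrightarrow> bounded (range (\<lambda>k. X k i))"
  shows "\<exists>r x. strict_mono r \<and> (\<forall>i\<in>I. (\<lambda>k. X (r k) i) \<longlonglongrightarrow> x i)"
  using assms
proof (induction I rule: finite_induct)
  case empty
  have "strict_mono (id :: nat \<Rightarrow> nat)" by (simp add: strict_mono_def)
  then show ?case by blast
next
  case (insert i0 I)
  then obtain r x where r: "strict_mono r" "\<forall>i\<in>I. (\<lambda>k. X (r k) i) \<longlonglongrightarrow> x i"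
    by auto
  have "bounded (range (\<lambda>k. X (r k) i0))"
    by (rule bounded_subset[OF insert.prems[of i0]]) auto
  then obtain l s where s: "strict_mono (s :: nat \<Rightarrow> nat)" "((\<lambda>k. X (r k) i0) \<circ> s) \<longlonglongrightarrow> l"
    using bounded_imp_convergent_subsequence by blast
  have "(\<lambda>k. X ((r \<circ> s) k) i) \<longlonglongrightarrow> (x(i0 := l)) i" if "i \<in> insert i0 I" for i
  proof (cases "i = i0")
    case True
    then show ?thesis using s(2) by (simp add: o_def)
  next
    case False
    then have "(\<lambda>k. X (r k) i) \<longlonglongrightarrow> x i" using that r by auto
    from LIMSEQ_subseq_LIMSEQ[OF this s(1)] show ?thesis using False by (simp add: o_def)
  qed
  then show ?case using strict_mono_o[OF r(1) s(1)] by blast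
qed

text \<open>Kuhn's combinatorial lemma on ever finer grids yields small cells in which each
  coordinate is not decreased by \<open>f\<close> at one vertex and not increased at another; a
  limit point of these cells is fixed. Continuity is sequential and asks for convergence in the
  coordinates from \<open>I\<close> only, so within the box the coordinates of \<open>f\<close> in
  \<open>I\<close> depend on no others.\<close>

lemma brouwer_box:
  fixes f :: "('i \<Rightarrow> real) \<Rightarrow> 'i \<Rightarrow> real"
  assumes fin: "finite I" and B: "0 < B"
    and maps: "\<And>x i. \<forall>i\<in>I. \<bar>x i\<bar> \<le> B \<Longrightarrow> i \<in> I \<Longrightarrow> \<bar>f x i\<bar> \<le> B"
    and cont: "\<And>X x i. \<forall>k. \<forall>i\<in>I. \<bar>X k i\<bar> \<le> B \<Longrightarrow> \<forall>i\<in>I. (\<lambda>k. X k i) \<longlonglongrightarrow> x i \<Longrightarrow> i \<in> I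
                 \<Longrightarrow> (\<lambda>k. f (X k) i) \<longlonglongrightarrow> f x i"
  shows "\<exists>x. \<forall>i\<in>I. \<bar>x i\<bar> \<le> B \<and> f x i = x i"
proof -
  define n where "n = card I"
  obtain h where h: "bij_betw h I {..<n}"
    using ex_bij_betw_finite_nat[OF fin] by (auto simp: n_def atLeast0LessThan)
  define e where "e = inv_into I h"
  have e: "e j \<in> I" "h (e j) = j" if "j < n" for j
    using that h unfolding e_def
    by (auto simp: bij_betw_def inv_into_into f_inv_into_f)
  have h': "h i < n" "e (h i) = i" if "i \<in> I" for i
    using that h unfolding e_def by (auto simp: bij_betw_def inv_into_f_f)
  \<comment> \<open>An affine map that takes the integer grid with coordinates from 0 to
    \<open>p\<close> onto an equidistant grid of the box.\<close>
  define g where "g p q i = B * (2 * (real (q (h i)) / real p) - 1)" for p :: nat and q :: "nat \<Rightarrow> nat" and i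
  \<comment> \<open>Label 0 records that \<open>f\<close> does not decrease coordinate
    \<open>j\<close>, label 1 that it does not increase it. On the faces the labels are prescribed
    as Kuhn's lemma demands; they remain truthful there because \<open>f\<close> maps the box into
    itself.\<close>
  define label where "label p q j = (if q j = 0 then 0 else if q j = p then 1 else
      if g p q (e j) \<le> f (g p q) (e j) then 0 else (1::nat))" for p q j
  have gB: "\<bar>g p q i\<bar> \<le> B" if "\<forall>j<n. q j \<le> p" "0 < p" "i \<in> I" for p q i
  proof -
    have "real (q (h i)) / real p \<le> 1" using that h' by simp
    moreover have "0 \<le> real (q (h i)) / real p" by simp
    ultimately have "\<bar>2 * (real (q (h i)) / real p) - 1\<bar> \<le> 1" by linarith
    then show ?thesis
      unfolding g_def abs_mult using B by (simp add: mult_left_le)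
  qed
  have lab0: "g p q (e j) \<le> f (g p q) (e j)" if "\<forall>j<n. q j \<le> p" "0 < p" "j < n" "label p q j = 0" for p q j
  proof (cases "q j = 0")
    case True
    then have "g p q (e j) = - B" using e that by (simp add: g_def)
    moreover have "\<bar>f (g p q) (e j)\<bar> \<le> B" using maps gB e that by blast
    ultimately show ?thesis by linarith
  next
    case False
    then show ?thesis using that(4) by (auto simp: label_def split: if_splits)
  qed
  have lab1: "f (g p q) (e j) \<le> g p q (e j)" if "\<forall>j<n. q j \<le> p" "0 < p" "j < n" "label p q j = 1" for p q j
  proof (cases "q j = p")
    case True
    then have "g p q (e j) = B" using e that by (simp add: g_def)
    moreover have "\<bar>f (g p q) (e j)\<bar> \<le> B" using maps gB e that by blast
    ultimately show ?thesis by linarith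
  next
    case False
    then show ?thesis using that(4) by (auto simp: label_def split: if_splits)
  qed
  define near where "near q u \<longleftrightarrow> (\<forall>j<n. q j \<le> u j \<and> u j \<le> q j + 1)" for q u :: "nat \<Rightarrow> nat"
  have lab01: "label p r i = 0 \<or> label p r i = 1" for p r i by (simp add: label_def)
  define cell where "cell k q \<longleftrightarrow> (\<forall>i<n. q i < Suc k) \<and> (\<forall>i. \<exists>r s. i < n \<longrightarrow> near q r \<and> near q s \<and>
    label (Suc k) r i = 0 \<and> label (Suc k) s i = 1)" for k q
  have "\<exists>q. cell k q" for k
  proof -
    have "\<forall>x. (\<forall>i<n. x i \<le> Suc k) \<longrightarrow> (\<forall>i<n. label (Suc k) x i = 0 \<or> label (Suc k) x i = 1)"
      "\<forall>x. (\<forall>i<n. x i \<le> Suc k) \<longrightarrow> (\<forall>i<n. x i = 0 \<longrightarrow> label (Suc k) x i = 0)"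
      "\<forall>x. (\<forall>i<n. x i \<le> Suc k) \<longrightarrow> (\<forall>i<n. x i = Suc k \<longrightarrow> label (Suc k) x i = 1)"
      by (auto simp: label_def)
    then obtain q where q: "\<forall>i<n. q i < Suc k" "\<forall>i<n. \<exists>r s. (\<forall>j<n. q j \<le> r j \<and> r j \<le> q j + 1) \<and>
      (\<forall>j<n. q j \<le> s j \<and> s j \<le> q j + 1) \<and> label (Suc k) r i \<noteq> label (Suc k) s i"
      by (rule kuhn_lemma[OF zero_less_Suc])
    \<comment> \<open>Kuhn's lemma gives two vertices with different labels; as the only labels are
      0 and 1, they can be named so that \<open>r\<close> has 0 and \<open>s\<close> has 1.\<close>
    have "\<exists>r s. i < n \<longrightarrow> near q r \<and> near q s \<and> label (Suc k) r i = 0 \<and> label (Suc k) s i = 1" for i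
      using q(2)[folded near_def] lab01[of "Suc k"] by metis
    then show ?thesis using q(1) unfolding cell_def by blast
  qed
  then obtain q where cell: "\<And>k. cell k (q k)" by metis
  have q: "\<forall>i<n. q k i < Suc k" for k using cell[of k] unfolding cell_def by blast
  have "\<exists>r s. i < n \<longrightarrow> near (q k) r \<and> near (q k) s \<and>
      label (Suc k) r i = 0 \<and> label (Suc k) s i = 1" for k i
    using cell[of k] unfolding cell_def by blast
  then have ex0: "\<exists>u. i < n \<longrightarrow> near (q k) u \<and> label (Suc k) u i = 0"
    and ex1: "\<exists>u. i < n \<longrightarrow> near (q k) u \<and> label (Suc k) u i = 1" for k i by blast+
  define r where "r k i = (SOME u. i < n \<longrightarrow> near (q k) u \<and> label (Suc k) u i = 0)" for k i
  define s where "s k i = (SOME u. i < n \<longrightarrow> near (q k) u \<and> label (Suc k) u i = 1)" for k i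
  have rs: "near (q k) (r k i) \<and> near (q k) (s k i) \<and>
      label (Suc k) (r k i) i = 0 \<and> label (Suc k) (s k i) i = 1" if "i < n" for k i
    using that someI_ex[OF ex0[where k=k and i=i], folded r_def] someI_ex[OF ex1[where k=k and i=i], folded s_def]
    by blast
  have r: "\<forall>j<n. q k j \<le> r k i j \<and> r k i j \<le> q k j + 1"
    and s: "\<forall>j<n. q k j \<le> s k i j \<and> s k i j \<le> q k j + 1"
    and r0: "label (Suc k) (r k i) i = 0" and s1: "label (Suc k) (s k i) i = 1" if "i < n" for k i
    using rs[OF that, of k] unfolding near_def by blast+
  have r': "\<forall>j<n. r k i j \<le> Suc k" if "i < n" for k i
    using r[OF that, of k] q[of k] by (metis Suc_eq_plus1 Suc_leI le_trans)
  have s': "\<forall>j<n. s k i j \<le> Suc k" if "i < n" for k i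
    using s[OF that, of k] q[of k] by (metis Suc_eq_plus1 Suc_leI le_trans)
  \<comment> \<open>One grid step has length \<open>2 * B / Suc k\<close>, so along the chosen
    subsequence all vertices of the cells tend to the same limit.\<close>
  have close: "\<bar>g (Suc k) u i - g (Suc k) (q k) i\<bar> \<le> 2 * B * inverse (real (Suc k))"
    if "\<forall>j<n. q k j \<le> u j \<and> u j \<le> q k j + 1" "i \<in> I" for k u i
  proof -
    have "q k (h i) \<le> u (h i)" "u (h i) \<le> q k (h i) + 1" using that h' by auto
    then have 1: "\<bar>real (u (h i)) - real (q k (h i))\<bar> \<le> 1" by linarith
    have "g (Suc k) u i - g (Suc k) (q k) i = 2 * B * inverse (real (Suc k)) * (real (u (h i)) - real (q k (h i)))"
      by (simp add: g_def field_simps del: of_nat_Suc)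
    then show ?thesis using 1 B by (simp add: abs_mult mult_left_le del: of_nat_Suc)
  qed
  have "bounded (range (\<lambda>k. g (Suc k) (q k) i))" if "i \<in> I" for i
    unfolding bounded_iff using gB[OF _ _ that] q by (auto intro!: exI[of _ B] simp: less_imp_le)
  from finite_coordinates_convergent_subsequence[OF fin, of "\<lambda>k. g (Suc k) (q k)", OF this] obtain \<rho> x
    where \<rho>: "strict_mono (\<rho> :: nat \<Rightarrow> nat)" and x: "\<forall>i\<in>I. (\<lambda>k. g (Suc (\<rho> k)) (q (\<rho> k)) i) \<longlonglongrightarrow> x i" by blast
  have lim: "(\<lambda>k. g (Suc (\<rho> k)) (u (\<rho> k)) i) \<longlonglongrightarrow> x i"
    if "\<forall>k. \<forall>j<n. q k j \<le> u k j \<and> u k j \<le> q k j + 1" "i \<in> I" for u i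
  proof -
    have "(\<lambda>k. 2 * B * inverse (real (Suc k))) \<longlonglongrightarrow> 2 * B * 0"
      by (intro tendsto_intros LIMSEQ_inverse_real_of_nat)
    then have "(\<lambda>k. g (Suc k) (u k) i - g (Suc k) (q k) i) \<longlonglongrightarrow> 0"
      by (rule_tac Lim_null_comparison[rotated]) (use close that in auto)
    from LIMSEQ_subseq_LIMSEQ[OF this \<rho>]
    have "(\<lambda>k. g (Suc (\<rho> k)) (u (\<rho> k)) i - g (Suc (\<rho> k)) (q (\<rho> k)) i) \<longlonglongrightarrow> 0" by (simp add: o_def)
    from tendsto_add[OF this x[rule_format, OF that(2)]] show ?thesis by simp
  qed
  have "\<bar>x i\<bar> \<le> B \<and> f x i = x i" if i: "i \<in> I" for i
  proof
    have "\<forall>k. \<bar>g (Suc (\<rho> k)) (q (\<rho> k)) i\<bar> \<le> B" using gB i q by (simp add: less_imp_le)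
    then show "\<bar>x i\<bar> \<le> B"
      using LIMSEQ_le_const2[OF tendsto_rabs[OF x[rule_format, OF i]]] by blast
    have hn: "h i < n" "e (h i) = i" using h' i by auto
    \<comment> \<open>Both vertex sequences tend to \<open>x\<close>. Along one of them
      \<open>f\<close> does not decrease coordinate \<open>i\<close>, along the other it does not
      increase it; the limits of the two inequalities give equality.\<close>
    have fr: "(\<lambda>k. f (g (Suc (\<rho> k)) (r (\<rho> k) (h i))) i) \<longlonglongrightarrow> f x i"
      by (rule cont) (use lim[of "\<lambda>k. r k (h i)"] r hn gB r' i in auto)
    have fs: "(\<lambda>k. f (g (Suc (\<rho> k)) (s (\<rho> k) (h i))) i) \<longlonglongrightarrow> f x i"
      by (rule cont) (use lim[of "\<lambda>k. s k (h i)"] s hn gB s' i in auto)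
    have "x i \<le> f x i"
      by (rule LIMSEQ_le[OF lim[of "\<lambda>k. r k (h i)"] fr])
        (use r hn i lab0[OF r' _ hn(1) r0] in auto)
    moreover have "f x i \<le> x i"
      by (rule LIMSEQ_le[OF fs lim[of "\<lambda>k. s k (h i)"]])
        (use s hn i lab1[OF s' _ hn(1) s1] in auto)
    ultimately show "f x i = x i" by simp
  qed
  then show ?thesis by blast
qed

subsection \<open>Real polynomials\<close>

definition linear_factors :: "real set \<Rightarrow> real poly" where
  "linear_factors Z = (\<Prod>w\<in>Z. [:-w, 1:])"

lemma poly_linear_factors: "poly (linear_factors Z) x = (\<Prod>w\<in>Z. x - w)"
  by (simp add: linear_factors_def poly_prod)

lemma degree_linear_factors: "degree (linear_factors Z) = card Z"
  unfolding linear_factors_def by (subst degree_prod_eq_sum_degree) auto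

lemma monic_linear_factors: "coeff (linear_factors Z) (card Z) = 1"
proof -
  have "lead_coeff (linear_factors Z) = 1"
    unfolding linear_factors_def by (simp add: lead_coeff_prod)
  then show ?thesis by (simp add: degree_linear_factors)
qed

text \<open>Counting roots pins the degree of \<open>T\<close> to \<open>card Z\<close>. The
  difference of the two sides then has smaller degree, because the leading terms cancel, but still
  vanishes on \<open>Z\<close>.\<close>

lemma linear_factors_eq:
  fixes T :: "real poly"
  assumes "finite Z" "\<And>w. w \<in> Z \<Longrightarrow> poly T w = 0" "T \<noteq> 0" "degree T \<le> card Z"
  shows "T = smult (lead_coeff T) (linear_factors Z)" "degree T = card Z"
proof -
  have "card Z \<le> card {x. poly T x = 0}"
    using assms poly_roots_finite by (intro card_mono) auto
  also have "\<dots> \<le> degree T" using card_poly_roots_bound[OF assms(3)] .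
  finally show deg: "degree T = card Z" using assms by simp
  define D where "D = T - smult (lead_coeff T) (linear_factors Z)"
  have "D = 0"
  proof (rule ccontr)
    assume D: "D \<noteq> 0"
    have "degree D \<le> card Z"
      unfolding D_def by (intro degree_diff_le) (auto simp: deg degree_linear_factors)
    moreover have "coeff D (card Z) = 0"
      unfolding D_def by (simp add: monic_linear_factors flip: deg) (simp add: deg monic_linear_factors)
    ultimately have "degree D < card Z"
      using D by (metis le_neq_implies_less leading_coeff_0_iff)
    moreover have "card Z \<le> card {x. poly D x = 0}"
    proof (intro card_mono poly_roots_finite D subsetI)
      fix w assume w: "w \<in> Z"
      then have "poly (linear_factors Z) w = 0"
        using assms(1) by (auto simp: poly_linear_factors)
      then show "w \<in> {x. poly D x = 0}" using assms(2) w by (simp add: D_def)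
    qed
    ultimately show False using card_poly_roots_bound[OF D] by linarith
  qed
  then show "T = smult (lead_coeff T) (linear_factors Z)" by (simp add: D_def)
qed

text \<open>Turns a bound on the zeros into a bound on the coefficients, which supplies both the
  invariant cube and compactness. A further zero \<open>w\<close> shifts the coefficients and
  subtracts \<open>w\<close> times them, at the cost of a factor \<open>1 + R\<close>.\<close>

lemma abs_coeff_linear_factors_le:
  assumes "finite Z" "\<And>w. w \<in> Z \<Longrightarrow> \<bar>w\<bar> \<le> R" "0 \<le> R"
  shows "\<bar>coeff (linear_factors Z) i\<bar> \<le> (1 + R) ^ card Z"
  using assms(1,2)
proof (induction Z arbitrary: i rule: finite_induct)
  case empty
  then show ?case by (cases i) (auto simp: linear_factors_def)
next
  case (insert w Z)
  let ?p = "linear_factors Z"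
  let ?C = "(1 + R) ^ card Z"
  have IH: "\<bar>coeff ?p i\<bar> \<le> ?C" for i using insert by auto
  have C: "0 \<le> ?C" using assms by simp
  have w: "\<bar>w\<bar> \<le> R" using insert by auto
  have eq: "linear_factors (insert w Z) = pCons 0 ?p - smult w ?p"
    using insert by (simp add: linear_factors_def)
  have 1: "\<bar>w * coeff ?p i\<bar> \<le> R * ?C" 
    unfolding abs_mult using w IH assms by (intro mult_mono) auto
  have 2: "\<bar>coeff (pCons 0 ?p) i\<bar> \<le> ?C"
    using IH C by (cases i) auto
  have "\<bar>coeff (linear_factors (insert w Z)) i\<bar> \<le> ?C + R * ?C"
    unfolding eq using 1 2 by simp
  then show ?case using insert by (simp add: algebra_simps)
qed

text \<open>This is the intermediate value theorem. The sign is given as a factor \<open>s\<close>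
  so that signs can be multiplied later.\<close>

lemma poly_constant_sign:
  fixes p :: "real poly"
  assumes "\<And>x. x \<in> {a..b} \<Longrightarrow> poly p x \<noteq> 0"
  obtains s where "s = 1 \<or> s = -1" "\<And>x. x \<in> {a..b} \<Longrightarrow> 0 < s * poly p x"
proof -
  have "(\<forall>x\<in>{a..b}. 0 \<le> poly p x) \<or> (\<forall>x\<in>{a..b}. poly p x \<le> 0)"
  proof (rule ccontr)
    assume "\<not> ?thesis"
    then obtain x y where xy: "x \<in> {a..b}" "y \<in> {a..b}" "poly p x < 0" "poly p y > 0"
      by (auto simp: not_le)
    have "connected (poly p ` {a..b})"
      by (intro connected_continuous_image continuous_intros) auto
    then have "0 \<in> poly p ` {a..b}"
      by (rule connectedD_interval[OF _ imageI[OF xy(1)] imageI[OF xy(2)]]) (use xy in auto)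
    then show False using assms by (metis imageE)
  qed
  then consider "\<And>x. x \<in> {a..b} \<Longrightarrow> 0 < 1 * poly p x" | "\<And>x. x \<in> {a..b} \<Longrightarrow> 0 < -1 * poly p x"
    using assms by force
  then show ?thesis by cases (use that in blast)+
qed

text \<open>The set constructed consists of the zeros of odd multiplicity in the interval. Splitting
  off one factor \<open>x - w\<close> toggles the membership of \<open>w\<close>: if
  \<open>w\<close> was in \<open>Z\<close>, the factor merely moves from the product over
  \<open>Z\<close> to \<open>p\<close>; otherwise it now occurs in both and contributes a
  square.\<close>

lemma sign_changes_factor:
  fixes p :: "real poly"
  assumes "p \<noteq> 0"
  shows "\<exists>Z s. finite Z \<and> Z \<subseteq> {a..b} \<and> (\<forall>w\<in>Z. poly p w = 0) \<and> (s = 1 \<or> s = -1) \<and>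
    (\<forall>x\<in>{a..b}. 0 \<le> s * (poly p x * poly (linear_factors Z) x))"
  using assms
proof (induction "degree p" arbitrary: p rule: less_induct)
  case less
  show ?case
  proof (cases "\<exists>w\<in>{a..b}. poly p w = 0")
    case False
    then obtain s where s: "s = 1 \<or> s = -1" "\<And>x. x \<in> {a..b} \<Longrightarrow> 0 < s * poly p x"
      by (metis poly_constant_sign)
    then have "\<forall>x\<in>{a..b}. 0 \<le> s * (poly p x * poly (linear_factors {}) x)"
      by (simp add: poly_linear_factors less_imp_le)
    then show ?thesis using s(1) by (metis empty_iff finite.emptyI empty_subsetI)
  next
    case True
    then obtain w where w: "w \<in> {a..b}" "poly p w = 0" by blast
    then obtain p' where p': "p = [:-w, 1:] * p'" by (metis poly_eq_0_iff_dvd dvdE)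
    with less.prems have nz: "p' \<noteq> 0" by auto
    then have "degree p' < degree p" unfolding p' by (subst degree_mult_eq) auto
    from less.hyps[OF this nz] obtain Z s where Z: "finite Z" "Z \<subseteq> {a..b}" "\<forall>w\<in>Z. poly p' w = 0"
      "s = 1 \<or> s = -1" "\<forall>x\<in>{a..b}. 0 \<le> s * (poly p' x * poly (linear_factors Z) x)"
      by (elim exE conjE)
    show ?thesis
    proof (cases "w \<in> Z")
      case True
      have "poly p x * poly (linear_factors (Z - {w})) x = poly p' x * poly (linear_factors Z) x" for x
        using Z(1) True by (simp add: p' poly_linear_factors prod.remove algebra_simps)
      then have "\<forall>x\<in>{a..b}. 0 \<le> s * (poly p x * poly (linear_factors (Z - {w})) x)"
        using Z by simp
      moreover have "\<forall>w\<in>Z - {w}. poly p w = 0" using Z by (simp add: p')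
      ultimately show ?thesis using Z by (intro exI[of _ "Z - {w}"] exI[of _ s]) auto
    next
      case False
      have eq: "s * (poly p x * poly (linear_factors (insert w Z)) x) =
        (x - w)\<^sup>2 * (s * (poly p' x * poly (linear_factors Z) x))" for x
        using Z(1) False by (simp add: p' poly_linear_factors power2_eq_square algebra_simps)
      have "\<forall>x\<in>{a..b}. 0 \<le> s * (poly p x * poly (linear_factors (insert w Z)) x)"
        unfolding eq using Z by simp
      moreover have "\<forall>w\<in>insert w Z. poly p w = 0" using Z by (simp add: p')
      ultimately show ?thesis using Z w by (intro exI[of _ "insert w Z"] exI[of _ s]) auto
    qed
  qed
qed

lemma poly_eq_sum_atMost:
  fixes p :: "'a::comm_semiring_1 poly"
  assumes "degree p \<le> N"
  shows "poly p x = (\<Sum>i\<le>N. coeff p i * x ^ i)"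
  unfolding poly_altdef
  by (rule sum.mono_neutral_left) (use assms in \<open>auto simp: coeff_eq_0\<close>)

lemma tendsto_poly_coeffwise:
  fixes T :: "nat \<Rightarrow> real poly"
  assumes "\<And>k. degree (T k) \<le> N" "degree S \<le> N" "\<And>i. (\<lambda>k. coeff (T k) i) \<longlonglongrightarrow> coeff S i"
  shows "(\<lambda>k. poly (T k) x) \<longlonglongrightarrow> poly S x"
  unfolding poly_eq_sum_atMost[OF assms(1)] poly_eq_sum_atMost[OF assms(2)]
  by (intro tendsto_intros assms)

lemma borel_measurable_poly [measurable]: "poly (p :: real poly) \<in> borel_measurable borel"
  by (intro borel_measurable_continuous_onI continuous_intros)

lemma poly_bounded_coeffwise:
  fixes p :: "real poly"
  assumes "degree p \<le> N" "\<And>i. \<bar>coeff p i\<bar> \<le> B" "\<bar>x\<bar> \<le> R"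
  shows "\<bar>poly p x\<bar> \<le> (\<Sum>i\<le>N. B * R ^ i)"
proof -
  have "0 \<le> B" using assms(2)[of 0] by linarith
  have "\<bar>poly p x\<bar> \<le> (\<Sum>i\<le>N. \<bar>coeff p i * x ^ i\<bar>)"
    unfolding poly_eq_sum_atMost[OF assms(1)] by (rule sum_abs)
  also have "\<dots> \<le> (\<Sum>i\<le>N. B * R ^ i)"
    unfolding abs_mult power_abs using assms \<open>0 \<le> B\<close> by (intro sum_mono mult_mono power_mono) auto
  finally show ?thesis .
qed

lemma poly_bounded_Icc:
  fixes p :: "real poly"
  obtains C where "\<And>x. x \<in> {a..b} \<Longrightarrow> \<bar>poly p x\<bar> \<le> C"
proof -
  have "compact (poly p ` {a..b})"
    by (intro compact_continuous_image continuous_intros) auto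
  from compact_imp_bounded[OF this] show ?thesis
    using that unfolding bounded_iff by (metis imageI real_norm_def)
qed

subsection \<open>Compactly supported measures\<close>

text \<open>The admissible densities for a varying measure: positivity makes the integral of a
  nonzero nonnegative polynomial positive, boundedness makes it finite. Both conditions concern only
  the interval that carries the measure.\<close>

definition weight_on :: "real \<Rightarrow> real \<Rightarrow> (real \<Rightarrow> real) \<Rightarrow> bool" where
  "weight_on a b g \<longleftrightarrow> g \<in> borel_measurable borel \<and> (\<forall>t\<in>{a..b}. 0 < g t) \<and> (\<exists>C. \<forall>t\<in>{a..b}. g t \<le> C)"

text \<open>The last assumption expresses infinite support in terms of null sets: a nonzero
  polynomial cannot vanish almost everywhere.\<close>

locale compact_measure = finite_measure \<mu> for \<mu> :: "real measure" +
  fixes a b :: real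
  assumes sets_eq: "sets \<mu> = sets borel"
    and AE_Icc: "AE t in \<mu>. t \<in> {a..b}"
    and not_AE_finite: "finite Z \<Longrightarrow> \<not> (AE t in \<mu>. t \<in> Z)"
begin

lemma measurable_eq: "borel_measurable \<mu> = borel_measurable borel"
  by (rule measurable_cong_sets[OF sets_eq refl])

lemma integrable_bounded:
  fixes f :: "real \<Rightarrow> real"
  assumes "f \<in> borel_measurable borel" "\<And>t. t \<in> {a..b} \<Longrightarrow> \<bar>f t\<bar> \<le> C"
  shows "integrable \<mu> f"
  by (rule integrable_const_bound[where B = C]) (use assms AE_Icc measurable_eq in auto)

lemma abs_integral_le:
  fixes f :: "real \<Rightarrow> real"
  assumes "f \<in> borel_measurable borel" "\<And>t. t \<in> {a..b} \<Longrightarrow> \<bar>f t\<bar> \<le> C"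
  shows "\<bar>integral\<^sup>L \<mu> f\<bar> \<le> C * measure \<mu> (space \<mu>)"
proof -
  have "\<bar>integral\<^sup>L \<mu> f\<bar> \<le> (\<integral>t. \<bar>f t\<bar> \<partial>\<mu>)" by (rule integral_abs_bound)
  also have "\<dots> \<le> (\<integral>t. C \<partial>\<mu>)"
  proof (rule integral_mono_AE)
    show "integrable \<mu> (\<lambda>t. \<bar>f t\<bar>)"
      using integrable_bounded[OF assms] by (rule integrable_abs)
    show "AE t in \<mu>. \<bar>f t\<bar> \<le> C" using AE_Icc by eventually_elim (rule assms(2))
  qed simp
  finally show ?thesis by (simp add: mult.commute)
qed

lemma integral_cong_Icc:
  fixes f :: "real \<Rightarrow> real"
  assumes "f \<in> borel_measurable borel" "g \<in> borel_measurable borel"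
    and "\<And>t. t \<in> {a..b} \<Longrightarrow> f t = g t"
  shows "integral\<^sup>L \<mu> f = integral\<^sup>L \<mu> g"
  by (rule integral_cong_AE) (use assms AE_Icc measurable_eq in auto)

lemma tendsto_integral:
  fixes f :: "nat \<Rightarrow> real \<Rightarrow> real"
  assumes "\<And>k. f k \<in> borel_measurable borel" "h \<in> borel_measurable borel"
    and "\<And>k t. t \<in> {a..b} \<Longrightarrow> \<bar>f k t\<bar> \<le> C"
    and "\<And>t. t \<in> {a..b} \<Longrightarrow> (\<lambda>k. f k t) \<longlonglongrightarrow> h t"
  shows "(\<lambda>k. integral\<^sup>L \<mu> (f k)) \<longlonglongrightarrow> integral\<^sup>L \<mu> h"
  by (rule integral_dominated_convergence[where w = "\<lambda>_. C"])
    (use assms AE_Icc measurable_eq in auto)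

lemma integrable_poly_weight:
  assumes "weight_on a b g"
  shows "integrable \<mu> (\<lambda>t. poly p t * g t)"
proof -
  from assms obtain C where C: "\<And>t. t \<in> {a..b} \<Longrightarrow> \<bar>g t\<bar> \<le> C"
    and [measurable]: "g \<in> borel_measurable borel"
    unfolding weight_on_def by (metis abs_of_pos)
  obtain D where D: "\<And>t. t \<in> {a..b} \<Longrightarrow> \<bar>poly p t\<bar> \<le> D" using poly_bounded_Icc by blast
  have "\<bar>poly p t * g t\<bar> \<le> D * C" if "t \<in> {a..b}" for t
    unfolding abs_mult using C[OF that] D[OF that] by (intro mult_mono) auto
  then show ?thesis by (intro integrable_bounded[where C = "D * C"]) auto
qed

text \<open>If the integral of this nonnegative function were zero, \<open>p\<close> would vanish
  almost everywhere and the measure would be carried by the finite set of its roots.\<close>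

lemma integral_poly_weight_pos:
  assumes g: "weight_on a b g" and "p \<noteq> 0" and "\<And>t. t \<in> {a..b} \<Longrightarrow> 0 \<le> s * poly p t" and "s \<noteq> 0"
  shows "0 < s * (\<integral>t. poly p t * g t \<partial>\<mu>)"
proof -
  have int: "integrable \<mu> (\<lambda>t. s * (poly p t * g t))"
    using integrable_poly_weight[OF g, of p] by simp
  have nn: "AE t in \<mu>. 0 \<le> s * (poly p t * g t)"
    using AE_Icc
  proof eventually_elim
    case (elim t)
    then have "0 \<le> s * poly p t" "0 \<le> g t" using assms by (auto simp: weight_on_def less_imp_le)
    then have "0 \<le> (s * poly p t) * g t" by (rule mult_nonneg_nonneg)
    then show ?case by (simp add: mult.assoc)
  qed
  have "(\<integral>t. s * (poly p t * g t) \<partial>\<mu>) \<noteq> 0"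
  proof
    assume "(\<integral>t. s * (poly p t * g t) \<partial>\<mu>) = 0"
    then have "AE t in \<mu>. s * (poly p t * g t) = 0"
      using integral_nonneg_eq_0_iff_AE[OF int nn] by simp
    with AE_Icc have "AE t in \<mu>. t \<in> {x. poly p x = 0}"
      by eventually_elim (use g \<open>s \<noteq> 0\<close> in \<open>force simp: weight_on_def\<close>)
    then show False using not_AE_finite poly_roots_finite[OF \<open>p \<noteq> 0\<close>] by blast
  qed
  moreover have "0 \<le> (\<integral>t. s * (poly p t * g t) \<partial>\<mu>)"
    by (rule integral_nonneg_AE[OF nn])
  ultimately have "0 < (\<integral>t. s * (poly p t * g t) \<partial>\<mu>)" by linarith
  then show ?thesis by simp
qed

end

text \<open>The complement of the support is a union of open null sets, and by the Lindelof property
  countably many of them suffice.\<close>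

lemma AE_msupport:
  assumes "sets \<sigma> = sets borel"
  shows "AE t in \<sigma>. t \<in> msupport \<sigma>"
proof -
  let ?F = "{U. open U \<and> emeasure \<sigma> U = 0}"
  obtain F' where F': "F' \<subseteq> ?F" "countable F'" "\<Union>F' = \<Union>?F"
    by (rule Lindelof[of ?F]) simp_all
  have "(\<Union>U\<in>F'. U) \<in> null_sets \<sigma>"
    by (rule null_sets_UN'[OF F'(2)]) (use F'(1) assms in \<open>auto simp: null_sets_def\<close>)
  then have "\<Union>F' \<in> null_sets \<sigma>" by simp
  moreover have "- msupport \<sigma> \<subseteq> \<Union>?F"
    unfolding msupport_def by (auto simp: not_gr_zero)
  ultimately show ?thesis
    using F'(3) by (intro AE_I'[of "\<Union>F'"]) auto
qed

text \<open>Take for \<open>a\<close> and \<open>b\<close> the least and the greatest point of the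
  support. If a finite set carried the measure, its complement would be an open null set and the
  support would be finite.\<close>

lemma borel_class_compact_measure:
  assumes "\<sigma> \<in> borel_class \<Delta>" "is_interval \<Delta>"
  obtains a b where "{a..b} \<subseteq> \<Delta>" "compact_measure \<sigma> a b"
proof -
  have sets: "sets \<sigma> = sets borel" and fin: "finite_measure \<sigma>" and comp: "compact (msupport \<sigma>)"
    and inf: "infinite (msupport \<sigma>)" and sub: "msupport \<sigma> \<subseteq> \<Delta>"
    using assms(1) by (auto simp: borel_class_def)
  have ne: "msupport \<sigma> \<noteq> {}" using inf by auto
  obtain a where a: "a \<in> msupport \<sigma>" "\<And>t. t \<in> msupport \<sigma> \<Longrightarrow> a \<le> t"
    using compact_attains_inf[OF comp ne] by blast
  obtain b where b: "b \<in> msupport \<sigma>" "\<And>t. t \<in> msupport \<sigma> \<Longrightarrow> t \<le> b"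
    using compact_attains_sup[OF comp ne] by blast
  have "{a..b} \<subseteq> \<Delta>"
    using assms(2) a(1) b(1) sub unfolding is_interval_1 by (meson atLeastAtMost_iff subset_eq)
  moreover have "compact_measure \<sigma> a b"
  proof (intro compact_measure.intro fin compact_measure_axioms.intro sets)
    show "AE t in \<sigma>. t \<in> {a..b}"
      using AE_msupport[OF sets] by eventually_elim (use a b in auto)
    fix Z :: "real set"
    assume Z: "finite Z"
    show "\<not> (AE t in \<sigma>. t \<in> Z)"
    proof
      assume "AE t in \<sigma>. t \<in> Z"
      moreover have "- Z \<in> sets \<sigma>" using Z sets by (simp add: finite_imp_closed borel_open open_Compl)
      moreover have "space \<sigma> = UNIV" using sets_eq_imp_space_eq[OF sets] by simp
      ultimately have "emeasure \<sigma> (- Z) = 0"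
        using AE_iff_measurable[of "- Z" \<sigma> "\<lambda>t. t \<in> Z"] by (simp add: Compl_eq)
      moreover have "open (- Z)" using Z by (simp add: finite_imp_closed open_Compl)
      ultimately have "x \<notin> msupport \<sigma>" if "x \<notin> Z" for x
        using that unfolding msupport_def by (auto intro!: exI[of _ "- Z"])
      then show False using Z inf finite_subset[of "msupport \<sigma>" Z] by blast
    qed
  qed
  ultimately show ?thesis using that by blast
qed

subsection \<open>Angelesco systems\<close>

text \<open>Gaussian elimination: the equation \<open>k0\<close> with pivot \<open>i0\<close>
  removes one unknown from the remaining equations.\<close>

lemma homogeneous_system_nontrivial_solution:
  fixes a :: "'k \<Rightarrow> 'i \<Rightarrow> 'a::field"
  assumes "finite K" "finite I" "card K < card I"
  shows "\<exists>c. (\<exists>i\<in>I. c i \<noteq> 0) \<and> (\<forall>k\<in>K. (\<Sum>i\<in>I. a k i * c i) = 0)"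
  using assms
proof (induction K arbitrary: I a rule: finite_induct)
  case empty
  then have "I \<noteq> {}" by auto
  then show ?case by (auto intro!: exI[of _ "\<lambda>_. 1"])
next
  case (insert k0 K)
  show ?case
  proof (cases "\<forall>i\<in>I. a k0 i = 0")
    case True
    have "card K < card I" using insert by simp
    from insert.IH[OF insert.prems(1) this, of a] True show ?thesis by auto
  next
    case False
    then obtain i0 where i0: "i0 \<in> I" "a k0 i0 \<noteq> 0" by blast
    define I' where "I' = I - {i0}"
    have fI': "finite I'" "i0 \<notin> I'" and I: "I = insert i0 I'"
      using insert i0 by (auto simp: I'_def)
    have "card K < card I'" using insert fI' I by simp
    from insert.IH[OF fI'(1) this, of "\<lambda>k i. a k i - a k i0 * a k0 i / a k0 i0"]
    obtain c where c: "\<exists>i\<in>I'. c i \<noteq> 0"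
      "\<forall>k\<in>K. (\<Sum>i\<in>I'. (a k i - a k i0 * a k0 i / a k0 i0) * c i) = 0" by blast
    define s where "s = (\<Sum>i\<in>I'. a k0 i * c i)"
    \<comment> \<open>The value at \<open>i0\<close> is the one that solves the equation
      \<open>k0\<close>; the equations in \<open>K\<close> then hold by the choice of the eliminated
      coefficients.\<close>
    define c' where "c' = c(i0 := - s / a k0 i0)"
    have sum: "(\<Sum>i\<in>I. a k i * c' i) = (\<Sum>i\<in>I'. a k i * c i) - a k i0 * s / a k0 i0" for k
    proof -
      have "(\<Sum>i\<in>I'. a k i * c' i) = (\<Sum>i\<in>I'. a k i * c i)"
        by (rule sum.cong) (use fI' in \<open>auto simp: c'_def\<close>)
      then show ?thesis using fI' by (simp add: I c'_def)
    qed
    have "(\<Sum>i\<in>I. a k i * c' i) = 0" if "k \<in> K" for k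
    proof -
      have "(\<Sum>i\<in>I'. (a k i - a k i0 * a k0 i / a k0 i0) * c i) =
         (\<Sum>i\<in>I'. a k i * c i) - a k i0 / a k0 i0 * s"
        by (simp add: s_def left_diff_distrib sum_subtractf sum_distrib_left mult.assoc)
      then show ?thesis using c(2) that sum by simp
    qed
    moreover have "(\<Sum>i\<in>I. a k0 i * c' i) = 0"
      using i0 by (simp add: sum) (simp add: s_def)
    moreover have "\<exists>i\<in>I. c' i \<noteq> 0"
    proof -
      obtain i where "i \<in> I'" "c i \<noteq> 0" using c by blast
      moreover have "c' i = c i" using \<open>i \<in> I'\<close> fI' by (auto simp: c'_def)
      ultimately show ?thesis using I by (metis insertI2)
    qed
    ultimately show ?thesis by blast
  qed
qed

text \<open>The index set is left general because the locale serves twice: for the measures on the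
  other intervals and, with a single index, for ordinary orthogonal polynomials.\<close>

locale angelesco =
  fixes J :: "'j set" and \<mu> :: "'j \<Rightarrow> real measure" and a b :: "'j \<Rightarrow> real" and n :: "'j \<Rightarrow> nat"
  assumes finite_J: "finite J"
    and measure: "j \<in> J \<Longrightarrow> compact_measure (\<mu> j) (a j) (b j)"
    and disjoint: "i \<in> J \<Longrightarrow> j \<in> J \<Longrightarrow> i \<noteq> j \<Longrightarrow> {a i..b i} \<inter> {a j..b j} = {}"
begin

definition N :: nat where "N = (\<Sum>j\<in>J. n j)"

definition weights :: "('j \<Rightarrow> real \<Rightarrow> real) \<Rightarrow> bool" where
  "weights g \<longleftrightarrow> (\<forall>j\<in>J. weight_on (a j) (b j) (g j))"

definition multi_orthogonal :: "('j \<Rightarrow> real \<Rightarrow> real) \<Rightarrow> real poly \<Rightarrow> bool" where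
  "multi_orthogonal g T \<longleftrightarrow> (\<forall>j\<in>J. \<forall>k<n j. (\<integral>t. poly T t * t ^ k * g j t \<partial>\<mu> j) = 0)"

lemma integrable_weights:
  assumes "weights g" "j \<in> J"
  shows "integrable (\<mu> j) (\<lambda>t. poly p t * g j t)"
  using compact_measure.integrable_poly_weight[OF measure[OF assms(2)]] assms by (auto simp: weights_def)

lemma integrable_weights_power:
  assumes "weights g" "j \<in> J"
  shows "integrable (\<mu> j) (\<lambda>t. poly p t * t ^ k * g j t)"
  using integrable_weights[OF assms, of "p * monom 1 k"] by (simp add: poly_monom)

lemma multi_orthogonalD:
  assumes "weights g" "multi_orthogonal g T" "j \<in> J" "degree q < n j"
  shows "(\<integral>t. poly T t * poly q t * g j t \<partial>\<mu> j) = 0"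
proof -
  have "(\<integral>t. poly T t * poly q t * g j t \<partial>\<mu> j) =
      (\<integral>t. (\<Sum>i\<le>degree q. coeff q i * (poly T t * t ^ i * g j t)) \<partial>\<mu> j)"
    by (simp add: poly_eq_sum_atMost[OF order.refl, of q] sum_distrib_left sum_distrib_right mult_ac)
  also have "\<dots> = (\<Sum>i\<le>degree q. coeff q i * (\<integral>t. poly T t * t ^ i * g j t \<partial>\<mu> j))"
    by (subst Bochner_Integration.integral_sum)
      (auto intro!: integrable_mult_right integrable_weights_power assms)
  also have "\<dots> = 0"
    using assms by (intro sum.neutral) (auto simp: multi_orthogonal_def)
  finally show ?thesis .
qed

lemma multi_orthogonal_diff:
  assumes "weights g" "multi_orthogonal g T" "multi_orthogonal g S"
  shows "multi_orthogonal g (T - S)"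
  unfolding multi_orthogonal_def
proof (intro ballI allI impI)
  fix j k assume jk: "j \<in> J" "k < n j"
  have "(\<integral>t. poly (T - S) t * t ^ k * g j t \<partial>\<mu> j) =
    (\<integral>t. poly T t * t ^ k * g j t - poly S t * t ^ k * g j t \<partial>\<mu> j)"
    by (simp add: algebra_simps)
  also have "\<dots> = 0"
    using assms jk by (subst Bochner_Integration.integral_diff)
      (auto intro!: integrable_weights_power simp: multi_orthogonal_def)
  finally show "(\<integral>t. poly (T - S) t * t ^ k * g j t \<partial>\<mu> j) = 0" .
qed

lemma multi_orthogonal_smult:
  assumes "multi_orthogonal g T"
  shows "multi_orthogonal g (smult c T)"
  using assms unfolding multi_orthogonal_def by (simp add: mult.assoc)

text \<open>With fewer than \<open>n j\<close> sign changes on \<open>{a j..b j}\<close>, the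
  polynomial with zeros at these changes would be orthogonal to \<open>T\<close>, although its
  product with \<open>T\<close> has constant sign. So each interval holds at least
  \<open>n j\<close> zeros. The intervals are disjoint and the degree is at most \<open>N\<close>,
  hence equality holds everywhere.\<close>

lemma zeros:
  assumes g: "weights g" and T: "multi_orthogonal g T" "T \<noteq> 0" "degree T \<le> N"
  obtains Z s where "\<And>j. j \<in> J \<Longrightarrow> finite (Z j)" "\<And>j. j \<in> J \<Longrightarrow> Z j \<subseteq> {a j..b j}" 
    "\<And>j. j \<in> J \<Longrightarrow> card (Z j) = n j"
    "\<And>j. j \<in> J \<Longrightarrow> s j = 1 \<or> s j = (-1 :: real)"
    "\<And>j t. j \<in> J \<Longrightarrow> t \<in> {a j..b j} \<Longrightarrow> 0 \<le> s j * poly (T * linear_factors (Z j)) t"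
    "card (\<Union>j\<in>J. Z j) = N"
    "T = smult (lead_coeff T) (linear_factors (\<Union>j\<in>J. Z j))" "degree T = N"
proof -
  have "\<forall>j. \<exists>Z s. finite Z \<and> Z \<subseteq> {a j..b j} \<and> (\<forall>w\<in>Z. poly T w = 0) \<and> (s = 1 \<or> s = -1) \<and>
    (\<forall>x\<in>{a j..b j}. 0 \<le> s * (poly T x * poly (linear_factors Z) x))"
    using sign_changes_factor[OF T(2)] by blast
  from choice[OF this] obtain Z where "\<forall>j. \<exists>s. finite (Z j) \<and> Z j \<subseteq> {a j..b j} \<and> (\<forall>w\<in>Z j. poly T w = 0) \<and> (s = 1 \<or> s = -1) \<and>
    (\<forall>x\<in>{a j..b j}. 0 \<le> s * (poly T x * poly (linear_factors (Z j)) x))" ..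
  from choice[OF this] obtain s where *: "\<forall>j. finite (Z j) \<and> Z j \<subseteq> {a j..b j} \<and> (\<forall>w\<in>Z j. poly T w = 0) \<and> (s j = 1 \<or> s j = -1) \<and>
    (\<forall>x\<in>{a j..b j}. 0 \<le> s j * (poly T x * poly (linear_factors (Z j)) x))" ..
  then have fin: "finite (Z j)" and sub: "Z j \<subseteq> {a j..b j}" and root: "w \<in> Z j \<Longrightarrow> poly T w = 0"
    and s: "s j = 1 \<or> s j = -1"
    and sgn: "t \<in> {a j..b j} \<Longrightarrow> 0 \<le> s j * poly (T * linear_factors (Z j)) t" for j w t
    by (simp_all)
  have ge: "n j \<le> card (Z j)" if j: "j \<in> J" for j
  proof (rule ccontr)
    assume "\<not> n j \<le> card (Z j)"
    then have "degree (linear_factors (Z j)) < n j" by (simp add: degree_linear_factors)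
    from multi_orthogonalD[OF g T(1) j this]
    have "s j * (\<integral>t. poly (T * linear_factors (Z j)) t * g j t \<partial>\<mu> j) = 0" by simp
    moreover have "linear_factors (Z j) \<noteq> 0"
      using monic_linear_factors[of "Z j"] by auto
    then have "0 < s j * (\<integral>t. poly (T * linear_factors (Z j)) t * g j t \<partial>\<mu> j)"
      using g j s[of j] T(2) sgn
      by (intro compact_measure.integral_poly_weight_pos[OF measure[OF j]]) (auto simp: weights_def)
    ultimately show False by (metis less_irrefl)
  qed
  let ?Z = "\<Union>j\<in>J. Z j"
  have cardZ: "card ?Z = (\<Sum>j\<in>J. card (Z j))"
  proof (rule card_UN_disjoint[OF finite_J])
    show "\<forall>i\<in>J. \<forall>j\<in>J. i \<noteq> j \<longrightarrow> Z i \<inter> Z j = {}"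
      using disjoint sub by blast
  qed (use fin in auto)
  have finZ: "finite ?Z" using fin finite_J by auto
  have rootZ: "poly T w = 0" if "w \<in> ?Z" for w using that root by auto
  have N_le: "N \<le> card ?Z" unfolding N_def cardZ by (intro sum_mono ge)
  then have deg_le: "degree T \<le> card ?Z" using T(3) by simp
  note lf = linear_factors_eq[OF finZ rootZ T(2) deg_le]
  have N_eq: "card ?Z = N" using N_le lf(2) T(3) by simp
  have "card (Z j) = n j" if j: "j \<in> J" for j
  proof (rule ccontr)
    assume "card (Z j) \<noteq> n j"
    then have "n j < card (Z j)" using ge[OF j] by simp
    then have "N < card ?Z" unfolding N_def cardZ
      using j ge finite_J by (intro sum_strict_mono_ex1) auto
    then show False using N_eq by simp
  qed
  then show ?thesis using that[of Z s] fin sub s sgn N_eq lf by auto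
qed

text \<open>Normalizing the coefficient at \<open>N\<close> instead of the leading one lets the
  condition pass to coefficientwise limits.\<close>

definition monic_multi_orthogonal :: "('j \<Rightarrow> real \<Rightarrow> real) \<Rightarrow> real poly \<Rightarrow> bool" where
  "monic_multi_orthogonal g T \<longleftrightarrow> multi_orthogonal g T \<and> degree T \<le> N \<and> coeff T N = 1"

text \<open>In the difference the coefficients at \<open>N\<close> cancel, whereas every nonzero
  multi-orthogonal polynomial of degree at most \<open>N\<close> has degree exactly
  \<open>N\<close>.\<close>

lemma monic_multi_orthogonal_unique:
  assumes g: "weights g" and T: "monic_multi_orthogonal g T" and S: "monic_multi_orthogonal g S"
  shows "T = S"
proof (rule ccontr)
  assume "T \<noteq> S"
  then have nz: "T - S \<noteq> 0" by simp
  have "degree (T - S) \<le> N"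
    using T S by (intro degree_diff_le) (auto simp: monic_multi_orthogonal_def)
  moreover have "multi_orthogonal g (T - S)"
    using T S multi_orthogonal_diff[OF g] by (auto simp: monic_multi_orthogonal_def)
  ultimately have "degree (T - S) = N"
    using nz zeros[OF g, of "T - S"] by metis
  then have "lead_coeff (T - S) = 0"
    using T S by (simp add: monic_multi_orthogonal_def)
  then show False using nz by (simp only: leading_coeff_0_iff)
qed

text \<open>Orthogonality imposes \<open>N\<close> homogeneous linear conditions on
  \<open>N + 1\<close> coefficients. A nontrivial solution has degree exactly \<open>N\<close> by
  \<open>zeros\<close>, so it can be made monic.\<close>

lemma monic_multi_orthogonal_exists:
  assumes g: "weights g"
  shows "\<exists>T. monic_multi_orthogonal g T"
proof -
  let ?K = "SIGMA j:J. {..<n j}"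
  have "card ?K = N" unfolding N_def using finite_J by simp
  then have "card ?K < card {..N}" by simp
  then obtain c where c: "\<exists>i\<in>{..N}. c i \<noteq> 0"
    "\<forall>jk\<in>?K. (\<Sum>i\<in>{..N}. (\<integral>t. t ^ i * t ^ snd jk * g (fst jk) t \<partial>\<mu> (fst jk)) * c i) = 0"
    using homogeneous_system_nontrivial_solution[of ?K "{..N}" "\<lambda>jk i. \<integral>t. t ^ i * t ^ snd jk * g (fst jk) t \<partial>\<mu> (fst jk)"]
      finite_J by blast
  define T where "T = (\<Sum>i\<le>N. monom (c i) i)"
  have coeff: "coeff T i = (if i \<le> N then c i else 0)" for i
    unfolding T_def coeff_sum by (simp add: sum.delta coeff_monom)
  have nz: "T \<noteq> 0" using c(1) coeff by (metis atMost_iff coeff_0)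
  have deg: "degree T \<le> N" by (rule degree_le) (simp add: coeff)
  have polyT: "poly T t = (\<Sum>i\<le>N. c i * t ^ i)" for t
    unfolding poly_eq_sum_atMost[OF deg] by (simp add: coeff)
  have ort: "multi_orthogonal g T"
    unfolding multi_orthogonal_def
  proof (intro ballI allI impI)
    fix j k assume jk: "j \<in> J" "k < n j"
    have int: "integrable (\<mu> j) (\<lambda>t. t ^ i * t ^ k * g j t)" for i
      using integrable_weights_power[OF g jk(1), of "monom 1 i" k] by (simp add: poly_monom)
    have "(\<integral>t. poly T t * t ^ k * g j t \<partial>\<mu> j) = (\<integral>t. (\<Sum>i\<le>N. t ^ i * t ^ k * g j t * c i) \<partial>\<mu> j)"
      by (simp add: polyT sum_distrib_left sum_distrib_right mult_ac)
    also have "\<dots> = (\<Sum>i\<le>N. (\<integral>t. t ^ i * t ^ k * g j t \<partial>\<mu> j) * c i)"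
      by (subst Bochner_Integration.integral_sum) (auto intro!: integrable_mult_left int)
    also have "\<dots> = 0" using c(2) jk by force
    finally show "(\<integral>t. poly T t * t ^ k * g j t \<partial>\<mu> j) = 0" .
  qed
  have "degree T = N" using zeros[OF g ort nz deg] by metis
  moreover from this have "coeff T N \<noteq> 0" using nz by (metis leading_coeff_0_iff)
  ultimately have "monic_multi_orthogonal g (smult (inverse (lead_coeff T)) T)"
    using multi_orthogonal_smult[OF ort] nz by (auto simp: monic_multi_orthogonal_def)
  then show ?thesis by blast
qed

definition mop :: "('j \<Rightarrow> real \<Rightarrow> real) \<Rightarrow> real poly" where
  "mop g = (THE T. monic_multi_orthogonal g T)"

lemma mop: "weights g \<Longrightarrow> monic_multi_orthogonal g (mop g)"
  unfolding mop_def using monic_multi_orthogonal_exists monic_multi_orthogonal_unique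
  by (metis theI)

lemma mop_zeros:
  assumes g: "weights g"
  obtains Z s where "\<forall>j\<in>J. finite (Z j) \<and> Z j \<subseteq> {a j..b j} \<and> card (Z j) = n j \<and> (s j = 1 \<or> s j = (-1 :: real)) \<and>
      (\<forall>t\<in>{a j..b j}. 0 \<le> s j * poly (mop g * linear_factors (Z j)) t)"
    "card (\<Union>j\<in>J. Z j) = N" "mop g = linear_factors (\<Union>j\<in>J. Z j)"
proof -
  have T: "multi_orthogonal g (mop g)" "degree (mop g) \<le> N" "coeff (mop g) N = 1"
    using mop[OF g] by (auto simp: monic_multi_orthogonal_def)
  then have nz: "mop g \<noteq> 0" by auto
  show ?thesis
  proof (rule zeros[OF g T(1) nz T(2)])
    fix Z s
    assume *: "\<And>j. j \<in> J \<Longrightarrow> finite (Z j)" "\<And>j. j \<in> J \<Longrightarrow> Z j \<subseteq> {a j..b j}" 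
    "\<And>j. j \<in> J \<Longrightarrow> card (Z j) = n j"
    "\<And>j. j \<in> J \<Longrightarrow> s j = 1 \<or> s j = (-1 :: real)"
    "\<And>j t. j \<in> J \<Longrightarrow> t \<in> {a j..b j} \<Longrightarrow> 0 \<le> s j * poly (mop g * linear_factors (Z j)) t"
    "card (\<Union>j\<in>J. Z j) = N"
    "mop g = smult (lead_coeff (mop g)) (linear_factors (\<Union>j\<in>J. Z j))" "degree (mop g) = N"
    then have "mop g = linear_factors (\<Union>j\<in>J. Z j)" using T(3) by simp
    then show thesis using * by (intro that[of Z s]) auto
  qed
qed

lemma degree_mop: "weights g \<Longrightarrow> degree (mop g) = N"
  by (rule mop_zeros[of g]) (auto simp: degree_linear_factors)

lemma coeff_mop: "weights g \<Longrightarrow> coeff (mop g) N = 1"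
  using mop by (simp add: monic_multi_orthogonal_def)

text \<open>All zeros lie in the intervals, whatever the weights are; hence the bound is uniform in
  \<open>g\<close>.\<close>

lemma abs_coeff_mop_le:
  assumes g: "weights g" and R: "\<And>j x. j \<in> J \<Longrightarrow> x \<in> {a j..b j} \<Longrightarrow> \<bar>x\<bar> \<le> R" "0 \<le> R"
  shows "\<bar>coeff (mop g) i\<bar> \<le> (1 + R) ^ N"
proof (rule mop_zeros[OF g])
  fix Z s
  assume "\<forall>j\<in>J. finite (Z j) \<and> Z j \<subseteq> {a j..b j} \<and> card (Z j) = n j \<and> (s j = 1 \<or> s j = (-1 :: real)) \<and>
      (\<forall>t\<in>{a j..b j}. 0 \<le> s j * poly (mop g * linear_factors (Z j)) t)"
    and **: "card (\<Union>j\<in>J. Z j) = N" "mop g = linear_factors (\<Union>j\<in>J. Z j)"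
  then have *: "\<And>j. j \<in> J \<Longrightarrow> finite (Z j)" "\<And>j. j \<in> J \<Longrightarrow> Z j \<subseteq> {a j..b j}" by auto
  have "finite (\<Union>j\<in>J. Z j)" using finite_J * by auto
  then have "\<bar>coeff (mop g) i\<bar> \<le> (1 + R) ^ card (\<Union>j\<in>J. Z j)"
    unfolding **(2) using R * by (intro abs_coeff_linear_factors_le) blast+
  then show ?thesis by (simp add: **(1))
qed

text \<open>The value at \<open>x\<close> is a product of \<open>N\<close> distances from
  \<open>x\<close> to points of the intervals.\<close>

lemma abs_poly_mop_ge:
  assumes g: "weights g" and \<delta>: "\<And>j t. j \<in> J \<Longrightarrow> t \<in> {a j..b j} \<Longrightarrow> \<delta> \<le> \<bar>x - t\<bar>" "0 \<le> \<delta>"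
  shows "\<delta> ^ N \<le> \<bar>poly (mop g) x\<bar>"
proof (rule mop_zeros[OF g])
  fix Z s
  assume "\<forall>j\<in>J. finite (Z j) \<and> Z j \<subseteq> {a j..b j} \<and> card (Z j) = n j \<and> (s j = 1 \<or> s j = (-1 :: real)) \<and>
      (\<forall>t\<in>{a j..b j}. 0 \<le> s j * poly (mop g * linear_factors (Z j)) t)"
    and **: "card (\<Union>j\<in>J. Z j) = N" "mop g = linear_factors (\<Union>j\<in>J. Z j)"
  then have *: "\<And>j. j \<in> J \<Longrightarrow> finite (Z j)" "\<And>j. j \<in> J \<Longrightarrow> Z j \<subseteq> {a j..b j}" by auto
  have "(\<Prod>w\<in>(\<Union>j\<in>J. Z j). \<delta>) \<le> (\<Prod>w\<in>(\<Union>j\<in>J. Z j). \<bar>x - w\<bar>)"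
    using * \<delta> by (intro prod_mono) blast
  then show ?thesis by (simp add: ** poly_linear_factors abs_prod)
qed

text \<open>Every limit point of the bounded sequence of coefficient vectors is again monic and
  multi-orthogonal, hence uniqueness identifies it.\<close>

lemma tendsto_coeff_mop:
  assumes g: "weights g" and gk: "\<And>k. weights (gk k)"
    and bound: "\<And>j. j \<in> J \<Longrightarrow> \<exists>C. \<forall>k. \<forall>t\<in>{a j..b j}. gk k j t \<le> C"
    and lim: "\<And>j t. j \<in> J \<Longrightarrow> t \<in> {a j..b j} \<Longrightarrow> (\<lambda>k. gk k j t) \<longlonglongrightarrow> g j t"
  shows "(\<lambda>k. coeff (mop (gk k)) i) \<longlonglongrightarrow> coeff (mop g) i"
proof -
  define R where "R = (\<Sum>j\<in>J. \<bar>a j\<bar> + \<bar>b j\<bar>)"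
  have R0: "0 \<le> R" unfolding R_def by (intro sum_nonneg) auto
  have R: "\<bar>x\<bar> \<le> R" if "j \<in> J" "x \<in> {a j..b j}" for j x
  proof -
    have "\<bar>a j\<bar> + \<bar>b j\<bar> \<le> R" unfolding R_def using that finite_J by (intro member_le_sum) auto
    then show ?thesis using that by auto
  qed
  let ?B = "(1 + R) ^ N"
  have cb: "\<bar>coeff (mop (gk k)) i\<bar> \<le> ?B" for k i
    using abs_coeff_mop_le[OF gk R R0] .
  have deg: "degree (mop (gk k)) \<le> N" for k using degree_mop[OF gk] by simp
  \<comment> \<open>Compactness gives a coefficientwise limit along a further subsequence; dominated
    convergence carries the orthogonality relations over to it.\<close>
  have sub: "\<exists>r. strict_mono r \<and> (\<lambda>k. coeff (mop (gk (\<rho> (r k)))) i) \<longlonglongrightarrow> coeff (mop g) i"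
    if \<rho>: "strict_mono \<rho>" for \<rho> :: "nat \<Rightarrow> nat"
  proof -
    have "bounded (range (\<lambda>k. coeff (mop (gk (\<rho> k))) i))" for i
      unfolding bounded_iff using cb by auto
    then obtain r x where r: "strict_mono (r :: nat \<Rightarrow> nat)"
      and x: "\<forall>i\<in>{..N}. (\<lambda>k. coeff (mop (gk (\<rho> (r k)))) i) \<longlonglongrightarrow> x i"
      using finite_coordinates_convergent_subsequence[of "{..N}" "\<lambda>k i. coeff (mop (gk (\<rho> k))) i"]
      by blast
    define T where "T = (\<Sum>i\<le>N. monom (x i) i)"
    have coeffT: "coeff T i = (if i \<le> N then x i else 0)" for i
      unfolding T_def coeff_sum by (simp add: sum.delta coeff_monom)
    have degT: "degree T \<le> N" by (rule degree_le) (simp add: coeffT)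
    have limT: "(\<lambda>k. coeff (mop (gk (\<rho> (r k)))) i) \<longlonglongrightarrow> coeff T i" for i
    proof (cases "i \<le> N")
      case True
      then show ?thesis using x by (simp add: coeffT)
    next
      case False
      then have "coeff (mop (gk (\<rho> (r k)))) i = 0" for k
        using deg[of "\<rho> (r k)"] by (intro coeff_eq_0) simp
      then show ?thesis using False by (simp add: coeffT)
    qed
    have "monic_multi_orthogonal g T"
      unfolding monic_multi_orthogonal_def multi_orthogonal_def
    proof (intro conjI ballI allI impI degT)
      show "coeff T N = 1"
        using limT[of N] by (simp add: coeff_mop[OF gk] LIMSEQ_const_iff)
      fix j k assume jk: "j \<in> J" "k < n j"
      obtain C where C: "\<And>k t. t \<in> {a j..b j} \<Longrightarrow> gk k j t \<le> C" using bound[OF jk(1)] by blast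
      have pos: "0 < gk k j t" if "t \<in> {a j..b j}" for k t
        using gk[of k] jk that by (auto simp: weights_def weight_on_def)
      have [measurable]: "gk k j \<in> borel_measurable borel" "g j \<in> borel_measurable borel" for k
        using gk[of k] g jk by (auto simp: weights_def weight_on_def)
      have "(\<lambda>k'. \<integral>t. poly (mop (gk (\<rho> (r k')))) t * t ^ k * gk (\<rho> (r k')) j t \<partial>\<mu> j) \<longlonglongrightarrow>
          (\<integral>t. poly T t * t ^ k * g j t \<partial>\<mu> j)"
      proof (rule compact_measure.tendsto_integral[OF measure[OF jk(1)],
            where C = "(\<Sum>i\<le>N. ?B * R ^ i) * R ^ k * C"])
        fix t assume t: "t \<in> {a j..b j}"
        have 1: "(\<lambda>k. gk (\<rho> (r k)) j t) \<longlonglongrightarrow> g j t"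
          using LIMSEQ_subseq_LIMSEQ[OF lim[OF jk(1) t] strict_mono_o[OF \<rho> r]] by (simp add: o_def)
        show "(\<lambda>k'. poly (mop (gk (\<rho> (r k')))) t * t ^ k * gk (\<rho> (r k')) j t) \<longlonglongrightarrow> poly T t * t ^ k * g j t"
          by (intro tendsto_mult 1 tendsto_const tendsto_poly_coeffwise[OF deg degT] limT)
        fix k'
        have "\<bar>poly (mop (gk (\<rho> (r k')))) t\<bar> \<le> (\<Sum>i\<le>N. ?B * R ^ i)"
          by (rule poly_bounded_coeffwise[OF deg cb R[OF jk(1) t]])
        moreover have "\<bar>t ^ k\<bar> \<le> R ^ k"
          unfolding power_abs using R[OF jk(1) t] by (intro power_mono) auto
        moreover have "\<bar>gk (\<rho> (r k')) j t\<bar> \<le> C" using pos[OF t] C[OF t] by (simp add: abs_of_pos)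
        ultimately show "\<bar>poly (mop (gk (\<rho> (r k')))) t * t ^ k * gk (\<rho> (r k')) j t\<bar> \<le> (\<Sum>i\<le>N. ?B * R ^ i) * R ^ k * C"
          unfolding abs_mult by (intro mult_mono) (auto intro!: sum_nonneg mult_nonneg_nonneg simp: R0)
      qed measurable
      moreover have "(\<integral>t. poly (mop (gk (\<rho> (r k')))) t * t ^ k * gk (\<rho> (r k')) j t \<partial>\<mu> j) = 0" for k'
        using mop[OF gk[of "\<rho> (r k')"]] jk by (simp add: monic_multi_orthogonal_def multi_orthogonal_def)
      ultimately show "(\<integral>t. poly T t * t ^ k * g j t \<partial>\<mu> j) = 0"
        by (simp add: LIMSEQ_const_iff)
    qed
    then have "T = mop g" using monic_multi_orthogonal_unique[OF g _ mop[OF g]] by blast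
    then show ?thesis using r limT by blast
  qed
  \<comment> \<open>If convergence failed, some subsequence would stay at distance at least
    \<open>e\<close> from the limit, against \<open>sub\<close>.\<close>
  show ?thesis
  proof (rule ccontr)
    assume "\<not> ?thesis"
    then obtain e where e: "0 < e" "\<And>k0. \<exists>k\<ge>k0. e \<le> dist (coeff (mop (gk k)) i) (coeff (mop g) i)"
      unfolding LIMSEQ_def by (meson not_le)
    then have "infinite {k. e \<le> dist (coeff (mop (gk k)) i) (coeff (mop g) i)}"
      unfolding infinite_nat_iff_unbounded_le by auto
    from infinite_enumerate[OF this] obtain \<rho> where \<rho>: "strict_mono (\<rho> :: nat \<Rightarrow> nat)"
      "\<forall>k. \<rho> k \<in> {k. e \<le> dist (coeff (mop (gk k)) i) (coeff (mop g) i)}" by blast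
    from sub[OF \<rho>(1)] obtain r where "(\<lambda>k. coeff (mop (gk (\<rho> (r k)))) i) \<longlonglongrightarrow> coeff (mop g) i" by blast
    from LIMSEQ_D[OF this e(1)] obtain k where "dist (coeff (mop (gk (\<rho> (r k)))) i) (coeff (mop g) i) < e"
      by (auto simp: dist_norm)
    then show False using \<rho>(2) by (simp add: not_less[symmetric])
  qed
qed

end

subsection \<open>Cauchy transforms\<close>

context compact_measure
begin

lemma borel_measurable_cauchy_integral:
  fixes f :: "real \<Rightarrow> real"
  assumes [measurable]: "f \<in> borel_measurable borel"
  shows "(\<lambda>x. \<integral>t. f t / (x - t) \<partial>\<mu>) \<in> borel_measurable borel"
proof -
  note sets_eq [measurable_cong]
  show ?thesis by measurable
qed

text \<open>On the interval \<open>s * u * W = 1\<close>, so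
  \<open>T x - s * W x * T t * u t\<close> is a combination of \<open>T x - T t\<close> and
  \<open>W x - W t\<close>. Dividing by \<open>x - t\<close> and integrating over \<open>t\<close>
  leaves a polynomial in \<open>x\<close>, and orthogonality of \<open>T\<close> removes its
  coefficients from \<open>N\<close> on.\<close>

lemma pade_remainder:
  fixes T W :: "real poly"
  assumes T: "degree T \<le> N" and W: "degree W \<le> N + n" and u: "weight_on a b u"
    and orth: "\<And>k. k < n \<Longrightarrow> (\<integral>t. poly T t * t ^ k * u t \<partial>\<mu>) = 0"
    and s: "s = 1 \<or> s = (-1 :: real)" and uW: "\<And>t. t \<in> {a..b} \<Longrightarrow> u t * poly W t = s"
  obtains S where "S = 0 \<or> degree S < N"
    "\<And>x. x \<notin> {a..b} \<Longrightarrow> poly T x * cauchy_transform \<mu> x - poly S x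
        = s * poly W x * (\<integral>t. poly T t * u t / (x - t) \<partial>\<mu>)"
proof -
  \<comment> \<open>The successor keeps \<open>M\<close> positive even when
    \<open>N + n = 0\<close>, as the factorization of \<open>p x - p t\<close> requires. In that
    factorization \<open>Q p k\<close>, a polynomial in \<open>t\<close>, is the coefficient of
    \<open>x ^ k\<close> in the divided difference.\<close>
  define M where "M = Suc (N + n)"
  define Q where "Q p k = (\<Sum>i=Suc k..M. monom (coeff p i) (i - k - 1))" for p :: "real poly" and k
  have Q: "poly p x - poly p t = (x - t) * (\<Sum>k<M. poly (Q p k) t * x ^ k)" if "degree p \<le> M" for p x t
    using polyfun_diff[of M "coeff p" x t]
    unfolding poly_eq_sum_atMost[OF that] by (simp add: Q_def poly_sum poly_monom M_def)
  have TM: "degree T \<le> M" and WM: "degree W \<le> M" using T W by (auto simp: M_def)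
  define c where "c k = (\<integral>t. poly (Q T k) t - s * (poly (T * Q W k) t * u t) \<partial>\<mu>)" for k
  have one: "weight_on a b (\<lambda>_. 1)" unfolding weight_on_def by auto
  have int1: "integrable \<mu> (\<lambda>t. poly p t)" for p
    using integrable_poly_weight[OF one, of p] by simp
  have int2: "integrable \<mu> (\<lambda>t. poly (Q T k) t - s * (poly (T * Q W k) t * u t))" for k
    by (intro Bochner_Integration.integrable_diff int1 integrable_mult_right integrable_poly_weight u)
  \<comment> \<open>For \<open>k\<close> at least \<open>N\<close> the part from \<open>T\<close> is
    zero by its degree, and the part from \<open>W\<close> has degree at most
    \<open>N + n - k - 1\<close> in \<open>t\<close>, hence below \<open>n\<close>, unless it is
    zero.\<close>
  have c0: "c k = 0" if "N \<le> k" for k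
  proof -
    have "coeff T i = 0" if "Suc k \<le> i" for i using that \<open>N \<le> k\<close> T by (intro coeff_eq_0) auto
    then have "Q T k = 0" unfolding Q_def by (intro sum.neutral) auto
    moreover have "(\<integral>t. poly (T * Q W k) t * u t \<partial>\<mu>) = 0"
    proof -
      have int: "integrable \<mu> (\<lambda>t. poly T t * t ^ l * u t)" for l
        using integrable_poly_weight[OF u, of "T * monom 1 l"] by (simp add: poly_monom)
      have "(\<integral>t. poly (T * Q W k) t * u t \<partial>\<mu>) =
          (\<integral>t. (\<Sum>i=Suc k..M. coeff W i * (poly T t * t ^ (i - k - 1) * u t)) \<partial>\<mu>)"
        by (simp add: Q_def poly_sum poly_monom sum_distrib_left sum_distrib_right mult_ac)
      also have "\<dots> = (\<Sum>i=Suc k..M. coeff W i * (\<integral>t. poly T t * t ^ (i - k - 1) * u t \<partial>\<mu>))"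
        by (subst Bochner_Integration.integral_sum) (auto intro!: integrable_mult_right int)
      also have "\<dots> = 0"
      proof (intro sum.neutral ballI)
        fix i assume i: "i \<in> {Suc k..M}"
        show "coeff W i * (\<integral>t. poly T t * t ^ (i - k - 1) * u t \<partial>\<mu>) = 0"
        proof (cases "i \<le> N + n")
          case True
          then have "i - k - 1 < n" using i that by auto
          then show ?thesis by (simp add: orth)
        next
          case False
          then have "coeff W i = 0" using W by (intro coeff_eq_0) auto
          then show ?thesis by simp
        qed
      qed
      finally show ?thesis .
    qed
    ultimately show ?thesis by (simp add: c_def)
  qed
  define S where "S = (\<Sum>k<N. monom (c k) k)"
  have "S = 0 \<or> degree S < N"
  proof (cases "N = 0")
    case False
    then have "degree S \<le> N - 1"
      unfolding S_def by (intro degree_sum_le) (auto intro: order.trans[OF degree_monom_le])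
    then show ?thesis using False by auto
  qed (simp add: S_def)
  moreover have "poly T x * cauchy_transform \<mu> x - poly S x
        = s * poly W x * (\<integral>t. poly T t * u t / (x - t) \<partial>\<mu>)" if x: "x \<notin> {a..b}" for x
  proof -
    have [measurable]: "u \<in> borel_measurable borel" using u by (simp add: weight_on_def)
    have "continuous_on {a..b} (\<lambda>t. 1 / \<bar>x - t\<bar>)"
      using x by (intro continuous_intros) auto
    then have "compact ((\<lambda>t. 1 / \<bar>x - t\<bar>) ` {a..b})" by (intro compact_continuous_image) auto
    from compact_imp_bounded[OF this] obtain D where D: "\<And>t. t \<in> {a..b} \<Longrightarrow> \<bar>1 / \<bar>x - t\<bar>\<bar> \<le> D"
      unfolding bounded_iff by (metis imageI real_norm_def)
    obtain C where C: "\<And>t. t \<in> {a..b} \<Longrightarrow> u t \<le> C" "\<And>t. t \<in> {a..b} \<Longrightarrow> 0 < u t"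
      using u unfolding weight_on_def by blast
    obtain E where E: "\<And>t. t \<in> {a..b} \<Longrightarrow> \<bar>poly T t\<bar> \<le> E" using poly_bounded_Icc by blast
    have i1: "integrable \<mu> (\<lambda>t. 1 / (x - t))"
      by (rule integrable_bounded[where C = D]) (use D in auto)
    have i2: "integrable \<mu> (\<lambda>t. poly T t * u t / (x - t))"
    proof (rule integrable_bounded[where C = "E * C * D"])
      fix t assume t: "t \<in> {a..b}"
      have "\<bar>poly T t * u t * (1 / \<bar>x - t\<bar>)\<bar> \<le> E * C * D"
        unfolding abs_mult using C[OF t] D[OF t] E[OF t]
        by (intro mult_mono) (auto intro!: mult_nonneg_nonneg)
      then show "\<bar>poly T t * u t / (x - t)\<bar> \<le> E * C * D" by (simp add: abs_mult)
    qed measurable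
    have pt: "poly T x * (1 / (x - t)) - s * poly W x * (poly T t * u t / (x - t)) =
        (\<Sum>k<M. (poly (Q T k) t - s * (poly (T * Q W k) t * u t)) * x ^ k)" if t: "t \<in> {a..b}" for t
    proof -
      have xt: "x - t \<noteq> 0" using x t by auto
      have ss: "s * (u t * poly W t) = 1" using s by (auto simp: uW[OF t])
      \<comment> \<open>The last summand vanishes by \<open>ss\<close>; the other two are divisible
        by \<open>x - t\<close>.\<close>
      have "(poly T x - s * poly W x * (poly T t * u t)) =
        (poly T x - poly T t) - s * poly T t * u t * (poly W x - poly W t)
         + poly T t * (1 - s * (u t * poly W t))" by (simp add: algebra_simps)
      also have "\<dots> = (x - t) * ((\<Sum>k<M. poly (Q T k) t * x ^ k) - s * poly T t * u t * (\<Sum>k<M. poly (Q W k) t * x ^ k))"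
        unfolding ss Q[OF TM] Q[OF WM] by (simp add: algebra_simps)
      also have "(\<Sum>k<M. poly (Q T k) t * x ^ k) - s * poly T t * u t * (\<Sum>k<M. poly (Q W k) t * x ^ k)
         = (\<Sum>k<M. (poly (Q T k) t - s * (poly (T * Q W k) t * u t)) * x ^ k)"
        unfolding sum_distrib_left sum_subtractf[symmetric] by (simp add: algebra_simps)
      finally have eq: "poly T x - s * poly W x * (poly T t * u t) =
          (x - t) * (\<Sum>k<M. (poly (Q T k) t - s * (poly (T * Q W k) t * u t)) * x ^ k)" .
      have "(poly T x - s * poly W x * (poly T t * u t)) / (x - t) =
          (\<Sum>k<M. (poly (Q T k) t - s * (poly (T * Q W k) t * u t)) * x ^ k)"
        unfolding eq by (rule nonzero_mult_div_cancel_left[OF xt])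
      then show ?thesis by (simp add: diff_divide_distrib)
    qed
    have "poly T x * cauchy_transform \<mu> x - s * poly W x * (\<integral>t. poly T t * u t / (x - t) \<partial>\<mu>)
      = (\<integral>t. poly T x * (1 / (x - t)) - s * poly W x * (poly T t * u t / (x - t)) \<partial>\<mu>)"
      unfolding cauchy_transform_def of_real_eq_id id_apply
      by (simp only: integral_mult_right_zero
        Bochner_Integration.integral_diff[OF integrable_mult_right[OF i1] integrable_mult_right[OF i2]])
    also have "\<dots> = (\<integral>t. (\<Sum>k<M. (poly (Q T k) t - s * (poly (T * Q W k) t * u t)) * x ^ k) \<partial>\<mu>)"
      by (rule integral_cong_Icc) (measurable, rule pt)
    also have "\<dots> = (\<Sum>k<M. c k * x ^ k)"
      unfolding c_def by (subst Bochner_Integration.integral_sum) (use int2 in auto)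
    also have "\<dots> = (\<Sum>k<N. c k * x ^ k)"
      by (rule sum.mono_neutral_right) (auto simp: M_def c0)
    also have "\<dots> = poly S x" by (simp add: S_def poly_sum poly_monom)
    finally show ?thesis by simp
  qed
  ultimately show ?thesis using that by blast
qed

end

context angelesco
begin

text \<open>Multiplying by the factor of \<open>mop g\<close> with zeros in \<open>{a j..b j}\<close> makes the integrand of
  constant sign; orthogonality allows this factor to be moved in and out of the integral.\<close>

lemma mop_cauchy_integral_sign:
  assumes g: "weights g" and j: "j \<in> J"
    and dis: "\<And>i. i \<in> J \<Longrightarrow> {c..d} \<inter> {a i..b i} = {}"
  obtains s where "s = 1 \<or> s = (-1 :: real)"
    "\<And>x. x \<in> {c..d} \<Longrightarrow> 0 < s * ((\<integral>t. poly (mop g) t * g j t / (x - t) \<partial>\<mu> j) / poly (mop g) x)"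
proof -
  interpret M: compact_measure "\<mu> j" "a j" "b j" by (rule measure[OF j])
  let ?T = "mop g"
  obtain Z s where Z: "\<forall>j\<in>J. finite (Z j) \<and> Z j \<subseteq> {a j..b j} \<and> card (Z j) = n j \<and> (s j = 1 \<or> s j = (-1 :: real)) \<and>
      (\<forall>t\<in>{a j..b j}. 0 \<le> s j * poly (?T * linear_factors (Z j)) t)"
    and "card (\<Union>j\<in>J. Z j) = N" and T: "?T = linear_factors (\<Union>j\<in>J. Z j)"
    by (rule mop_zeros[OF g])
  then have fin: "\<And>j. j \<in> J \<Longrightarrow> finite (Z j)" and sub: "\<And>j. j \<in> J \<Longrightarrow> Z j \<subseteq> {a j..b j}"
    by auto
  have card: "card (Z j) = n j" and s: "s j = 1 \<or> s j = -1"
    and sgn: "\<And>t. t \<in> {a j..b j} \<Longrightarrow> 0 \<le> s j * poly (?T * linear_factors (Z j)) t"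
    using Z j by auto
  let ?q = "linear_factors (Z j)"
  have ort: "multi_orthogonal g ?T" using mop[OF g] by (simp add: monic_multi_orthogonal_def)
  have finZ: "finite (\<Union>j\<in>J. Z j)" using fin finite_J by auto
  have nz: "?q \<noteq> 0" "?T \<noteq> 0" using monic_linear_factors[of "Z j"] coeff_mop[OF g] by auto
  have T_nz: "poly ?T x \<noteq> 0" and q_nz: "poly ?q x \<noteq> 0" if "x \<in> {c..d}" for x
  proof -
    have "x \<notin> (\<Union>j\<in>J. Z j)" using that dis sub by blast
    then show "poly ?T x \<noteq> 0" "poly ?q x \<noteq> 0"
      using finZ fin[OF j] j unfolding T by (auto simp: poly_linear_factors)
  qed
  then have "poly (?T * ?q) x \<noteq> 0" if "x \<in> {c..d}" for x using that by simp
  then obtain e1 where e1: "e1 = 1 \<or> e1 = -1" "\<And>x. x \<in> {c..d} \<Longrightarrow> 0 < e1 * poly (?T * ?q) x"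
    using poly_constant_sign[of c d "?T * ?q"] by blast
  \<comment> \<open>The sign of \<open>x - t\<close>. If \<open>d < a j\<close> fails,
    \<open>{c..d}\<close> lies to the right of \<open>{a j..b j}\<close>, since otherwise the larger
    of \<open>x\<close> and \<open>a j\<close> would be a common point.\<close>
  obtain e2 :: real where e2: "e2 = 1 \<or> e2 = -1"
    "\<And>x t. x \<in> {c..d} \<Longrightarrow> t \<in> {a j..b j} \<Longrightarrow> e2 * \<bar>x - t\<bar> = x - t"
  proof (cases "d < a j")
    case True
    then show ?thesis by (intro that[of "-1"]) auto
  next
    case False
    have "b j < x" if "x \<in> {c..d}" "a j \<le> b j" for x
    proof (rule ccontr)
      assume "\<not> b j < x"
      then have "max x (a j) \<in> {c..d} \<inter> {a j..b j}" using False that by auto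
      then show False using dis[OF j] by (metis empty_iff)
    qed
    then show ?thesis by (intro that[of 1]) force+
  qed
  have [measurable]: "g j \<in> borel_measurable borel" using g j by (simp add: weights_def weight_on_def)
  have pos: "0 < (s j * e1 * e2) * ((\<integral>t. poly ?T t * g j t / (x - t) \<partial>\<mu> j) / poly ?T x)"
    if x: "x \<in> {c..d}" for x
  proof -
    let ?H = "\<integral>t. poly ?T t * g j t / (x - t) \<partial>\<mu> j"
    let ?g = "\<lambda>t. g j t / \<bar>x - t\<bar>"
    have xn: "x \<noteq> t" if "t \<in> {a j..b j}" for t using that x dis[OF j] by auto
    have "continuous_on {a j..b j} (\<lambda>t. 1 / \<bar>x - t\<bar>)"
      using xn by (intro continuous_intros) auto
    then have "compact ((\<lambda>t. 1 / \<bar>x - t\<bar>) ` {a j..b j})" by (intro compact_continuous_image) auto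
    from compact_imp_bounded[OF this] obtain D where D: "\<And>t. t \<in> {a j..b j} \<Longrightarrow> \<bar>1 / \<bar>x - t\<bar>\<bar> \<le> D"
      unfolding bounded_iff by (metis imageI real_norm_def)
    obtain C where C: "\<And>t. t \<in> {a j..b j} \<Longrightarrow> g j t \<le> C" "\<And>t. t \<in> {a j..b j} \<Longrightarrow> 0 < g j t"
      using g j unfolding weights_def weight_on_def by blast
    have g': "weight_on (a j) (b j) ?g"
      unfolding weight_on_def
    proof (intro conjI ballI exI)
      fix t assume t: "t \<in> {a j..b j}"
      show "0 < ?g t" using C(2)[OF t] xn[OF t] by simp
      have "g j t * (1 / \<bar>x - t\<bar>) \<le> C * D"
        using C[OF t] D[OF t] by (intro mult_mono) auto
      then show "?g t \<le> C * D" by simp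
    qed measurable
    have posq: "0 < s j * (\<integral>t. poly (?T * ?q) t * ?g t \<partial>\<mu> j)"
      using s sgn nz by (intro M.integral_poly_weight_pos[OF g']) auto
    \<comment> \<open>The quotient \<open>r\<close> of \<open>q t - q x\<close> by
      \<open>t - x\<close> is zero or of degree below \<open>n j\<close>, so \<open>mop g\<close> is
      orthogonal to it and \<open>q t\<close> may be replaced by \<open>q x\<close> in the
      integral.\<close>
    have "poly (?q - [:poly ?q x:]) x = 0" by simp
    then obtain r where r: "?q - [:poly ?q x:] = [:-x, 1:] * r" by (metis poly_eq_0_iff_dvd dvdE)
    have r0: "(\<integral>t. poly ?T t * poly r t * g j t \<partial>\<mu> j) = 0"
    proof (cases "r = 0")
      case False
      have "degree ([:-x, 1:] * r) = Suc (degree r)" using False by (subst degree_mult_eq) auto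
      moreover have "degree ([:-x, 1:] * r) \<le> n j"
        unfolding r[symmetric] by (intro degree_diff_le) (auto simp: degree_linear_factors card)
      ultimately have "degree r < n j" by simp
      then show ?thesis by (rule multi_orthogonalD[OF g ort j])
    qed simp
    have eq: "(\<integral>t. poly (?T * ?q) t * ?g t \<partial>\<mu> j) =
        (\<integral>t. e2 * poly ?q x * (poly ?T t * g j t / (x - t)) - e2 * (poly ?T t * poly r t * g j t) \<partial>\<mu> j)"
    proof (rule M.integral_cong_Icc)
      fix t assume t: "t \<in> {a j..b j}"
      have "poly (?q - [:poly ?q x:]) t = poly ([:-x, 1:] * r) t" by (simp only: r)
      then have qt: "poly ?q t = poly ?q x - (x - t) * poly r t" by (simp add: algebra_simps)
      have "1 / \<bar>x - t\<bar> = e2 / (x - t)"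
        using e2(2)[OF x t] xn[OF t] e2(1) by (auto simp: field_simps)
      then have "poly (?T * ?q) t * ?g t = poly ?T t * (poly ?q x - (x - t) * poly r t) * g j t * (e2 / (x - t))"
        by (simp add: qt divide_inverse mult.assoc)
      then show "poly (?T * ?q) t * ?g t =
        e2 * poly ?q x * (poly ?T t * g j t / (x - t)) - e2 * (poly ?T t * poly r t * g j t)"
        using xn[OF t] by (simp add: field_simps)
    qed measurable
    have i1: "integrable (\<mu> j) (\<lambda>t. poly ?T t * g j t / (x - t))"
    proof -
      have "integrable (\<mu> j) (\<lambda>t. e2 * (poly ?T t * ?g t))"
        by (intro integrable_mult_right M.integrable_poly_weight[OF g'])
      then show ?thesis
      proof (rule integrable_cong_AE_imp)
        show "AE t in \<mu> j. e2 * (poly ?T t * ?g t) = poly ?T t * g j t / (x - t)" 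
          using M.AE_Icc
        proof eventually_elim
          case (elim t)
          have "1 / \<bar>x - t\<bar> = e2 / (x - t)"
            using e2(2)[OF x elim] xn[OF elim] e2(1) by (auto simp: field_simps)
          then show ?case using e2(1) by (auto simp: divide_inverse)
        qed
      qed (simp add: M.measurable_eq)
    qed
    have i2: "integrable (\<mu> j) (\<lambda>t. poly ?T t * poly r t * g j t)"
      using integrable_weights[OF g j, of "?T * r"] by simp
    have "(\<integral>t. poly (?T * ?q) t * ?g t \<partial>\<mu> j) = e2 * poly ?q x * ?H"
      by (simp only: eq r0 integral_mult_right_zero mult_zero_right diff_zero
        Bochner_Integration.integral_diff[OF integrable_mult_right[OF i1] integrable_mult_right[OF i2]])
    then have "0 < s j * (e2 * poly ?q x * ?H)" using posq by simp
    \<comment> \<open>The unknown sign of \<open>q x\<close> is absorbed into a square, which leaves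
      \<open>s j * e1 * e2\<close> as the sign of \<open>H / T\<close>, the same for all
      \<open>x\<close>.\<close>
    then have "0 < (s j * (e2 * poly ?q x * ?H)) * (e1 * poly (?T * ?q) x)"
      using e1(2)[OF x] by (rule mult_pos_pos)
    then have "0 < (poly ?q x * poly ?T x)\<^sup>2 * ((s j * e1 * e2) * (?H / poly ?T x))"
      using T_nz[OF x] by (simp add: power2_eq_square field_simps)
    then show ?thesis
      by (rule zero_less_mult_pos) (use T_nz[OF x] q_nz[OF x] in simp)
  qed
  have "s j * e1 * e2 = 1 \<or> s j * e1 * e2 = -1" using s e1(1) e2(1) by auto
  then show ?thesis using that pos by blast
qed

end

context compact_measure
begin

interpretation single: angelesco "{0::nat}" "\<lambda>_. \<mu>" "\<lambda>_. a" "\<lambda>_. b" "\<lambda>_. d" for d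
  by unfold_locales auto

text \<open>Ordinary orthogonality is the case of one measure with multi-index \<open>d\<close>, so
  existence, location of zeros and continuity in the weight are inherited.\<close>

definition monic_op :: "nat \<Rightarrow> (real \<Rightarrow> real) \<Rightarrow> real poly" where
  "monic_op d g = angelesco.mop {0::nat} (\<lambda>_. \<mu>) (\<lambda>_. d) (\<lambda>_. g)"

lemma single_weights: "single.weights (\<lambda>_. g) \<longleftrightarrow> weight_on a b g"
  by (simp add: single.weights_def)

lemma single_N: "single.N d = d"
  by (simp add: single.N_def)

lemma degree_monic_op: "weight_on a b g \<Longrightarrow> degree (monic_op d g) = d"
  using single.degree_mop[of "\<lambda>_. g" d] by (simp add: monic_op_def single_weights single_N)

lemma coeff_monic_op: "weight_on a b g \<Longrightarrow> coeff (monic_op d g) d = 1"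
  using single.coeff_mop[of "\<lambda>_. g" d] by (simp add: monic_op_def single_weights single_N)

lemma monic_op_orthogonal:
  assumes "weight_on a b g" "degree q < d"
  shows "(\<integral>t. poly (monic_op d g) t * poly q t * g t \<partial>\<mu>) = 0"
  using single.multi_orthogonalD[of "\<lambda>_. g" d "monic_op d g" 0 q] single.mop[of "\<lambda>_. g" d] assms
  by (simp add: monic_op_def single_weights single.monic_multi_orthogonal_def)

lemma abs_coeff_monic_op_le:
  assumes "weight_on a b g" "\<bar>a\<bar> \<le> R" "\<bar>b\<bar> \<le> R"
  shows "\<bar>coeff (monic_op d g) i\<bar> \<le> (1 + R) ^ d"
proof -
  have "\<bar>x\<bar> \<le> R" if "x \<in> {a..b}" for x using assms(2,3) that by auto
  then show ?thesis
    using single.abs_coeff_mop_le[of "\<lambda>_. g" R d i] assms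
    by (simp add: monic_op_def single_weights single_N)
qed

lemma abs_poly_monic_op_ge:
  assumes "weight_on a b g" "\<And>t. t \<in> {a..b} \<Longrightarrow> \<delta> \<le> \<bar>x - t\<bar>" "0 \<le> \<delta>"
  shows "\<delta> ^ d \<le> \<bar>poly (monic_op d g) x\<bar>"
  using single.abs_poly_mop_ge[of "\<lambda>_. g" \<delta> x d] assms
  by (simp add: monic_op_def single_weights single_N)

lemma tendsto_coeff_monic_op:
  assumes "weight_on a b g" "\<And>k. weight_on a b (gk k)"
    and "\<And>k t. t \<in> {a..b} \<Longrightarrow> gk k t \<le> C"
    and "\<And>t. t \<in> {a..b} \<Longrightarrow> (\<lambda>k. gk k t) \<longlonglongrightarrow> g t"
  shows "(\<lambda>k. coeff (monic_op d (gk k)) i) \<longlonglongrightarrow> coeff (monic_op d g) i"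
  unfolding monic_op_def
proof (rule single.tendsto_coeff_mop)
  show "\<exists>C. \<forall>k. \<forall>t\<in>{a..b}. gk k t \<le> C" using assms(3) by blast
qed (use assms in \<open>auto simp: single_weights\<close>)

end

subsection \<open>The fixed point\<close>

theorem lemma5:
  fixes m :: nat
    and \<Delta> :: "nat \<Rightarrow> real set"
    and \<sigma> :: "nat \<Rightarrow> real measure"
    and l :: "nat \<Rightarrow> real poly"
    and n :: "nat \<Rightarrow> nat"
  assumes "\<And>k. k \<le> m \<Longrightarrow> is_interval (\<Delta> k)"
    and "disjoint_family_on \<Delta> {0..m}"
    and "\<And>k. k \<le> m \<Longrightarrow> \<sigma> k \<in> borel_class (\<Delta> k)"
    and "orthonormal_polys (\<sigma> 0) l"
  shows "\<exists>T S. nonlinear_fourier_pade m (\<sigma> 0) l \<sigma> n T S"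
proof -

  \<comment> \<open>Compact intervals carrying the measures, and their separation\<close>
  have "\<forall>k\<in>{..m}. \<exists>ab. {fst ab..snd ab} \<subseteq> \<Delta> k \<and> compact_measure (\<sigma> k) (fst ab) (snd ab)"
  proof
    fix k assume "k \<in> {..m}"
    then obtain u v where "{u..v} \<subseteq> \<Delta> k" "compact_measure (\<sigma> k) u v"
      using borel_class_compact_measure assms(1,3) by (metis atMost_iff)
    then show "\<exists>ab. {fst ab..snd ab} \<subseteq> \<Delta> k \<and> compact_measure (\<sigma> k) (fst ab) (snd ab)"
      by (intro exI[of _ "(u, v)"]) simp
  qed
  from bchoice[OF this] obtain ab
    where ab: "\<And>k. k \<le> m \<Longrightarrow> {fst (ab k)..snd (ab k)} \<subseteq> \<Delta> k"
      "\<And>k. k \<le> m \<Longrightarrow> compact_measure (\<sigma> k) (fst (ab k)) (snd (ab k))" by auto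
  define a where "a k = fst (ab k)" for k
  define b where "b k = snd (ab k)" for k
  have cm: "compact_measure (\<sigma> k) (a k) (b k)" if "k \<le> m" for k
    using ab(2)[OF that] by (simp add: a_def b_def)
  have dis: "{a i..b i} \<inter> {a k..b k} = {}" if "i \<le> m" "k \<le> m" "i \<noteq> k" for i k
  proof -
    have "\<Delta> i \<inter> \<Delta> k = {}" using assms(2) that unfolding disjoint_family_on_def by simp
    then show ?thesis using ab(1)[OF that(1)] ab(1)[OF that(2)] unfolding a_def b_def by blast
  qed
  interpret A: angelesco "{1..m}" \<sigma> a b n
  proof (rule angelesco.intro)
    show "compact_measure (\<sigma> j) (a j) (b j)" if "j \<in> {1..m}" for j using cm that by simp
    show "{a i..b i} \<inter> {a j..b j} = {}" if "i \<in> {1..m}" "j \<in> {1..m}" "i \<noteq> j" for i j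
      using that by (intro dis) simp_all
  qed simp
  interpret O: compact_measure "\<sigma> 0" "a 0" "b 0" using cm by simp
  define N where "N = (\<Sum>j=1..m. n j)"
  have AN: "A.N = N" by (simp only: A.N_def N_def)
  define d where "d j = N + n j" for j
  let ?U = "\<Union>j\<in>{1..m}. {a j..b j}"
  have dis0: "{a 0..b 0} \<inter> {a j..b j} = {}" if "j \<in> {1..m}" for j
    using that by (intro dis) auto
  then have "{a 0..b 0} \<inter> ?U = {}" by blast
  moreover have "compact ?U" by (intro compact_UN) auto
  ultimately obtain \<delta> where \<delta>0: "0 < \<delta>" and "\<forall>x\<in>{a 0..b 0}. \<forall>t\<in>?U. \<delta> \<le> dist x t"
    using separate_compact_closed[of "{a 0..b 0}" ?U] compact_imp_closed by blast
  then have \<delta>: "\<delta> \<le> \<bar>x - t\<bar>" if "x \<in> {a 0..b 0}" "j \<in> {1..m}" "t \<in> {a j..b j}" for x j t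
    using that by (auto simp: dist_real_def)
  \<comment> \<open>The radius also covers the interval of \<open>\<sigma> 0\<close>: the zeros of
    \<open>T\<close> lie in the other intervals, those of \<open>V\<close> in this one.\<close>
  define R where "R = (\<Sum>j\<in>{0..m}. \<bar>a j\<bar> + \<bar>b j\<bar>)"
  have R0: "0 \<le> R" unfolding R_def by (intro sum_nonneg) auto
  have R: "\<bar>a j\<bar> + \<bar>b j\<bar> \<le> R" if "j \<le> m" for j
    unfolding R_def using that by (intro member_le_sum) auto
  have R_Icc: "\<bar>x\<bar> \<le> R" if "j \<le> m" "x \<in> {a j..b j}" for j x
    using R[OF that(1)] that(2) by auto

  \<comment> \<open>The self-map of the coefficient space\<close>
  define W where "W c j = monom 1 (d j) + (\<Sum>i<d j. monom (c (j, i)) i)" for c :: "nat \<times> nat \<Rightarrow> real" and j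
  \<comment> \<open>The cutoff makes the weight positive for every \<open>c\<close> in the box, so that Brouwer's theorem
    applies to a cube; at a fixed point it is inactive, as \<open>W c j\<close> then has all zeros in \<open>{a 0..b 0}\<close>.\<close>
  define u where "u c j t = 1 / max \<bar>poly (W c j) t\<bar> (\<delta> ^ d j)" for c j t
  define T where "T c = A.mop (u c)" for c
  define H where "H c j x = (\<integral>t. poly (T c) t * u c j t / (x - t) \<partial>\<sigma> j)" for c j x
  \<comment> \<open>The quotient has constant sign on \<open>{a 0..b 0}\<close>, so the absolute
    value changes it by a constant factor only and makes it a weight.\<close>
  define \<omega> where "\<omega> c j x = \<bar>H c j x / poly (T c) x\<bar>" for c j x
  define V where "V c j = O.monic_op (d j) (\<omega> c j)" for c j
  \<comment> \<open>The coordinates are the pairs \<open>(j, i)\<close> with \<open>i < d j\<close>;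
    the leading coefficients are fixed to be 1.\<close>
  define \<Phi> where "\<Phi> c ji = coeff (V c (fst ji)) (snd ji)" for c and ji :: "nat \<times> nat"

  have coeff_W: "coeff (W c j) i = (if i < d j then c (j, i) else if i = d j then 1 else 0)" for c j i
    unfolding W_def by (auto simp: coeff_sum coeff_monom)
  have deg_W: "degree (W c j) \<le> d j" for c j by (rule degree_le) (simp add: coeff_W)

  \<comment> \<open>Bounds uniform in the coefficient vector\<close>
  have u_pos: "0 < u c j t" for c j t using \<delta>0 by (simp add: u_def less_max_iff_disj)
  have u_le: "u c j t \<le> 1 / \<delta> ^ d j" for c j t
    unfolding u_def using \<delta>0 by (intro divide_left_mono) (auto simp: less_max_iff_disj)
  have u_meas [measurable]: "u c j \<in> borel_measurable borel" for c j
    unfolding u_def by measurable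
  have wu: "A.weights (u c)" for c
    unfolding A.weights_def weight_on_def using u_pos u_le u_meas by blast
  have T_deg: "degree (T c) \<le> N" for c unfolding T_def AN[symmetric] by (rule eq_imp_le[OF A.degree_mop[OF wu]])
  have T_coeff: "\<bar>coeff (T c) i\<bar> \<le> (1 + R) ^ N" for c i
    unfolding T_def AN[symmetric] using R_Icc R0 by (intro A.abs_coeff_mop_le wu) auto
  define CT where "CT = (\<Sum>i\<le>N. (1 + R) ^ N * R ^ i)"
  have T_le: "\<bar>poly (T c) t\<bar> \<le> CT" if "j \<le> m" "t \<in> {a j..b j}" for c j t
    unfolding CT_def by (rule poly_bounded_coeffwise[OF T_deg T_coeff R_Icc[OF that]])
  have CT0: "0 \<le> CT" unfolding CT_def using R0 by (intro sum_nonneg) auto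
  have T_ge: "\<delta> ^ N \<le> \<bar>poly (T c) x\<bar>" if "x \<in> {a 0..b 0}" for c x
    unfolding T_def AN[symmetric] using \<delta>[OF that] \<delta>0 by (intro A.abs_poly_mop_ge wu) auto
  have T_nz: "poly (T c) x \<noteq> 0" if "x \<in> {a 0..b 0}" for c x
    using T_ge[OF that, of c] zero_less_power[OF \<delta>0, of N] by auto

  define K where "K j = CT * (1 / \<delta> ^ d j) * (1 / \<delta>)" for j
  have integrand_le: "\<bar>poly (T c) t * u c j t / (x - t)\<bar> \<le> K j"
    if "j \<in> {1..m}" "x \<in> {a 0..b 0}" "t \<in> {a j..b j}" for c j x t
  proof -
    have 1: "\<bar>poly (T c) t\<bar> \<le> CT" using T_le that by auto
    have 2: "\<bar>u c j t\<bar> \<le> 1 / \<delta> ^ d j" using u_pos u_le by (simp add: abs_of_pos)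
    have 3: "1 / \<bar>x - t\<bar> \<le> 1 / \<delta>"
      using \<delta>[OF that(2,1,3)] \<delta>0 by (intro divide_left_mono) auto
    have "\<bar>poly (T c) t\<bar> * \<bar>u c j t\<bar> * (1 / \<bar>x - t\<bar>) \<le> K j"
      unfolding K_def using 1 2 3 CT0 \<delta>0 by (intro mult_mono) auto
    then show ?thesis by (simp add: abs_mult)
  qed
  have H_meas [measurable]: "H c j \<in> borel_measurable borel" if "j \<in> {1..m}" for c j
    unfolding H_def using cm[of j] that by (intro compact_measure.borel_measurable_cauchy_integral) auto
  have H_le: "\<bar>H c j x\<bar> \<le> K j * measure (\<sigma> j) (space (\<sigma> j))"
    if "j \<in> {1..m}" "x \<in> {a 0..b 0}" for c j x
    unfolding H_def using that by (intro compact_measure.abs_integral_le[OF cm] integrand_le) auto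

  have sign_H: "\<exists>s. (s = 1 \<or> s = (-1 :: real)) \<and> (\<forall>x\<in>{a 0..b 0}. 0 < s * (H c j x / poly (T c) x))"
    if j: "j \<in> {1..m}" for c j
  proof -
    from A.mop_cauchy_integral_sign[OF wu j dis0] obtain s where "s = 1 \<or> s = (-1 :: real)"
      "\<And>x. x \<in> {a 0..b 0} \<Longrightarrow> 0 < s * (H c j x / poly (T c) x)"
      unfolding H_def T_def by blast
    then show ?thesis by blast
  qed
  define L where "L j = K j * measure (\<sigma> j) (space (\<sigma> j)) * (1 / \<delta> ^ N)" for j
  have \<omega>_le: "\<omega> c j x \<le> L j" if "j \<in> {1..m}" "x \<in> {a 0..b 0}" for c j x
  proof -
    have "1 / \<bar>poly (T c) x\<bar> \<le> 1 / \<delta> ^ N"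
      using T_ge[OF that(2), of c] \<delta>0 by (intro divide_left_mono) (auto simp: T_nz[OF that(2)])
    then have "\<bar>H c j x\<bar> * (1 / \<bar>poly (T c) x\<bar>) \<le> L j"
      unfolding L_def using H_le[OF that, of c] by (intro mult_mono) auto
    then show ?thesis by (simp add: \<omega>_def)
  qed
  have w\<omega>: "weight_on (a 0) (b 0) (\<omega> c j)" if j: "j \<in> {1..m}" for c j
    unfolding weight_on_def
  proof (intro conjI ballI exI)
    note H_meas[OF j, measurable]
    show "\<omega> c j \<in> borel_measurable borel" unfolding \<omega>_def by measurable
    fix x assume x: "x \<in> {a 0..b 0}"
    show "\<omega> c j x \<le> L j" by (rule \<omega>_le[OF j x])
    obtain s where "0 < s * (H c j x / poly (T c) x)" using sign_H[OF j] x by blast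
    then have "H c j x / poly (T c) x \<noteq> 0" by (metis less_irrefl mult_zero_right)
    then show "0 < \<omega> c j x" unfolding \<omega>_def by (rule zero_less_abs_iff[THEN iffD2])
  qed

  \<comment> \<open>Brouwer's theorem on a cube of coefficients\<close>
  define I where "I = (SIGMA j:{1..m}. {..<d j})"
  \<comment> \<open>The coefficients of \<open>V c j\<close> are bounded by
    \<open>(1 + R) ^ d j\<close>; the sum in the exponent gives one bound for all
    \<open>j\<close>.\<close>
  define B where "B = (1 + R) ^ (\<Sum>j\<in>{1..m}. d j)"
  have "\<exists>c. \<forall>i\<in>I. \<bar>c i\<bar> \<le> B \<and> \<Phi> c i = c i"
  proof (rule brouwer_box)
    show "finite I" unfolding I_def by auto
    show "0 < B" unfolding B_def using R0 by (intro zero_less_power) auto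
    fix c :: "nat \<times> nat \<Rightarrow> real" and ji assume "ji \<in> I"
    then obtain j i where ji: "ji = (j, i)" "j \<in> {1..m}" "i < d j" unfolding I_def by auto
    have "\<bar>a 0\<bar> \<le> R" "\<bar>b 0\<bar> \<le> R" using R[of 0] by auto
    then have "\<bar>coeff (V c j) i\<bar> \<le> (1 + R) ^ d j"
      unfolding V_def by (rule O.abs_coeff_monic_op_le[OF w\<omega>[OF ji(2)]])
    also have "\<dots> \<le> B" unfolding B_def
      using R0 ji(2) by (intro power_increasing member_le_sum) auto
    finally show "\<bar>\<Phi> c ji\<bar> \<le> B" by (simp add: \<Phi>_def ji)
  next
    fix X :: "nat \<Rightarrow> nat \<times> nat \<Rightarrow> real" and c ji
    assume lim: "\<forall>i\<in>I. (\<lambda>k. X k i) \<longlonglongrightarrow> c i" and "ji \<in> I"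
    then obtain j i where ji: "ji = (j, i)" "j \<in> {1..m}" "i < d j" unfolding I_def by auto
    \<comment> \<open>Continuity is followed through the chain \<open>W\<close>, \<open>u\<close>,
      \<open>T\<close>, \<open>H\<close>, \<open>\<omega>\<close>, \<open>V\<close>; the uniform
      bounds supply the dominating constants.\<close>
    have lim_W: "(\<lambda>k. poly (W (X k) j) t) \<longlonglongrightarrow> poly (W c j) t" if "j \<in> {1..m}" for j t
    proof (rule tendsto_poly_coeffwise[OF deg_W deg_W])
      fix i show "(\<lambda>k. coeff (W (X k) j) i) \<longlonglongrightarrow> coeff (W c j) i"
        using lim that by (auto simp: coeff_W I_def)
    qed
    have lim_u: "(\<lambda>k. u (X k) j t) \<longlonglongrightarrow> u c j t" if "j \<in> {1..m}" for j t
      unfolding u_def using \<delta>0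
      by (intro tendsto_divide tendsto_const tendsto_max tendsto_rabs lim_W that)
        (auto simp: max_def)
    have "(\<lambda>k. coeff (T (X k)) i) \<longlonglongrightarrow> coeff (T c) i" for i
      unfolding T_def using u_le
      by (intro A.tendsto_coeff_mop wu lim_u) blast+
    then have lim_T: "(\<lambda>k. poly (T (X k)) x) \<longlonglongrightarrow> poly (T c) x" for x
      by (rule tendsto_poly_coeffwise[OF T_deg T_deg])
    have lim_H: "(\<lambda>k. H (X k) j x) \<longlonglongrightarrow> H c j x" if x: "x \<in> {a 0..b 0}" for x
      unfolding H_def
    proof (rule compact_measure.tendsto_integral[OF cm])
      show "j \<le> m" using ji by auto
      fix t assume t: "t \<in> {a j..b j}"
      have "x - t \<noteq> 0" using \<delta>[OF x ji(2) t] \<delta>0 by auto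
      then show "(\<lambda>k. poly (T (X k)) t * u (X k) j t / (x - t)) \<longlonglongrightarrow> poly (T c) t * u c j t / (x - t)"
        by (intro tendsto_divide tendsto_mult tendsto_const lim_T lim_u ji)
      show "\<bar>poly (T (X k)) t * u (X k) j t / (x - t)\<bar> \<le> K j" for k
        by (rule integrand_le[OF ji(2) x t])
    qed measurable
    have "(\<lambda>k. \<omega> (X k) j x) \<longlonglongrightarrow> \<omega> c j x" if x: "x \<in> {a 0..b 0}" for x
      unfolding \<omega>_def by (intro tendsto_rabs tendsto_divide lim_H lim_T T_nz x)
    then have "(\<lambda>k. coeff (V (X k) j) i) \<longlonglongrightarrow> coeff (V c j) i"
      unfolding V_def by (intro O.tendsto_coeff_monic_op[where C = "L j"] w\<omega> \<omega>_le ji) auto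
    then show "(\<lambda>k. \<Phi> (X k) ji) \<longlonglongrightarrow> \<Phi> c ji" by (simp add: \<Phi>_def ji)
  qed
  then obtain c where c: "\<And>i. i \<in> I \<Longrightarrow> \<Phi> c i = c i" by blast

  \<comment> \<open>The fixed point and the inactive cutoff\<close>
  have VW: "V c j = W c j" if j: "j \<in> {1..m}" for j
  proof (rule poly_eqI)
    fix i
    show "coeff (V c j) i = coeff (W c j) i"
    proof (cases "i < d j")
      case True
      then have "\<Phi> c (j, i) = c (j, i)" using j by (intro c) (simp add: I_def)
      then show ?thesis using True by (simp add: \<Phi>_def coeff_W)
    next
      case False
      then show ?thesis
        using O.coeff_monic_op[OF w\<omega>[OF j], of "d j" c] O.degree_monic_op[OF w\<omega>[OF j], of "d j" c]
        by (auto simp: coeff_W V_def coeff_eq_0)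
    qed
  qed
  have uW: "\<exists>s. (s = 1 \<or> s = (-1 :: real)) \<and> (\<forall>t\<in>{a j..b j}. u c j t * poly (W c j) t = s)"
    if j: "j \<in> {1..m}" for j
  proof -
    \<comment> \<open>By \<open>VW\<close> the zeros of \<open>W c j\<close> lie in
      \<open>{a 0..b 0}\<close>, each at distance at least \<open>\<delta>\<close> from
      \<open>t\<close>; this is what fixes the level \<open>\<delta> ^ d j\<close> of the
      cutoff.\<close>
    have W_ge: "\<delta> ^ d j \<le> \<bar>poly (W c j) t\<bar>" if t: "t \<in> {a j..b j}" for t
      unfolding VW[OF j, symmetric] V_def
    proof (rule O.abs_poly_monic_op_ge[OF w\<omega>[OF j]])
      show "\<delta> \<le> \<bar>t - x\<bar>" if "x \<in> {a 0..b 0}" for x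
        using \<delta>[OF that j t] by (simp add: abs_minus_commute)
    qed (use \<delta>0 in simp)
    then have "poly (W c j) t \<noteq> 0" if "t \<in> {a j..b j}" for t
      using that zero_less_power[OF \<delta>0, of "d j"] by fastforce
    then obtain s where s: "s = 1 \<or> s = (-1 :: real)" "\<And>t. t \<in> {a j..b j} \<Longrightarrow> 0 < s * poly (W c j) t"
      using poly_constant_sign[of "a j" "b j" "W c j"] by blast
    have "u c j t * poly (W c j) t = s" if t: "t \<in> {a j..b j}" for t
    proof -
      have "u c j t = 1 / \<bar>poly (W c j) t\<bar>" unfolding u_def using W_ge[OF t] by (simp add: max_def)
      then show ?thesis using s(1) s(2)[OF t] by auto
    qed
    then show ?thesis using s(1) by blast
  qed

  \<comment> \<open>Numerators from the remainder formula\<close>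
  have "\<exists>S. (S = 0 \<or> degree S < N) \<and> (\<exists>s. \<forall>x\<in>{a 0..b 0}.
      cauchy_transform (\<sigma> j) x - poly S x / poly (T c) x = s * poly (W c j) x * \<omega> c j x)"
    if j: "j \<in> {1..m}" for j
  proof -
    have jm: "j \<le> m" using j by auto
    obtain s where s: "s = 1 \<or> s = (-1 :: real)" "\<And>t. t \<in> {a j..b j} \<Longrightarrow> u c j t * poly (W c j) t = s"
      using uW[OF j] by blast
    obtain s' where s': "s' = 1 \<or> s' = (-1 :: real)"
      "\<And>x. x \<in> {a 0..b 0} \<Longrightarrow> 0 < s' * (H c j x / poly (T c) x)"
      using sign_H[OF j] by blast
    have orth: "(\<integral>t. poly (T c) t * t ^ k * u c j t \<partial>\<sigma> j) = 0" if "k < n j" for k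
      using A.mop[OF wu[of c]] j that
      unfolding A.monic_multi_orthogonal_def A.multi_orthogonal_def T_def by blast
    have wuj: "weight_on (a j) (b j) (u c j)" using wu[of c] j unfolding A.weights_def by blast
    obtain S where S: "S = 0 \<or> degree S < N"
      "\<And>x. x \<notin> {a j..b j} \<Longrightarrow> poly (T c) x * cauchy_transform (\<sigma> j) x - poly S x
        = s * poly (W c j) x * H c j x"
      using compact_measure.pade_remainder[OF cm[OF jm] T_deg deg_W[unfolded d_def] wuj orth s]
      unfolding H_def by blast
    have "cauchy_transform (\<sigma> j) x - poly S x / poly (T c) x = (s * s') * poly (W c j) x * \<omega> c j x"
      if x: "x \<in> {a 0..b 0}" for x
    proof -
      have "x \<notin> {a j..b j}" using x dis0[OF j] by blast
      from S(2)[OF this] have "cauchy_transform (\<sigma> j) x - poly S x / poly (T c) x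
          = s * poly (W c j) x * (H c j x / poly (T c) x)"
        using T_nz[OF x, of c] by (simp add: field_simps)
      \<comment> \<open>The absolute value is undone by the sign \<open>s'\<close>, which does not
        depend on \<open>x\<close>, so \<open>s * s'\<close> is a constant factor of the
        remainder.\<close>
      also have "H c j x / poly (T c) x = s' * \<omega> c j x"
      proof -
        have "y = s' * \<bar>y\<bar>" if "0 < s' * y" for y using s'(1) that by auto
        then show ?thesis unfolding \<omega>_def using s'(2)[OF x] by blast
      qed
      finally show ?thesis by simp
    qed
    then show ?thesis using S(1) by blast
  qed
  then have "\<forall>j\<in>{1..m}. \<exists>S. (S = 0 \<or> degree S < N) \<and> (\<exists>s. \<forall>x\<in>{a 0..b 0}.
      cauchy_transform (\<sigma> j) x - poly S x / poly (T c) x = s * poly (W c j) x * \<omega> c j x)" by blast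
  from bchoice[OF this] obtain S where S: "\<And>j. j \<in> {1..m} \<Longrightarrow> S j = 0 \<or> degree (S j) < N"
    and rem: "\<And>j. j \<in> {1..m} \<Longrightarrow> \<exists>s. \<forall>x\<in>{a 0..b 0}.
      cauchy_transform (\<sigma> j) x - poly (S j) x / poly (T c) x = s * poly (W c j) x * \<omega> c j x" by blast

  \<comment> \<open>Vanishing of the integrals\<close>
  have "has_bochner_integral (\<sigma> 0)
      (\<lambda>x. (cauchy_transform (\<sigma> j) x - poly (S j) x / poly (T c) x) * poly (l k) x) 0"
    if j: "j \<in> {1..m}" and k: "k < d j" for j k
  proof -
    obtain s where s: "\<And>x. x \<in> {a 0..b 0} \<Longrightarrow>
      cauchy_transform (\<sigma> j) x - poly (S j) x / poly (T c) x = s * poly (W c j) x * \<omega> c j x"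
      using rem[OF j] by blast
    \<comment> \<open>Since \<open>l k\<close> has degree \<open>k\<close>, the range
      \<open>k < N + n j\<close> is exactly where \<open>W c j\<close>, of degree
      \<open>d j\<close>, is orthogonal.\<close>
    have "degree (l k) < d j" using k assms(4) by (simp add: orthonormal_polys_def)
    then have "(\<integral>x. poly (W c j) x * poly (l k) x * \<omega> c j x \<partial>\<sigma> 0) = 0"
      unfolding VW[OF j, symmetric] V_def by (rule O.monic_op_orthogonal[OF w\<omega>[OF j]])
    moreover have "integrable (\<sigma> 0) (\<lambda>x. poly (W c j) x * poly (l k) x * \<omega> c j x)"
      using O.integrable_poly_weight[OF w\<omega>[OF j], of "W c j * l k"] by simp
    ultimately have "has_bochner_integral (\<sigma> 0) (\<lambda>x. poly (W c j) x * poly (l k) x * \<omega> c j x) 0"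
      by (simp add: has_bochner_integral_iff)
    from has_bochner_integral_mult_right[OF this, of s]
    have "has_bochner_integral (\<sigma> 0) (\<lambda>x. s * (poly (W c j) x * poly (l k) x * \<omega> c j x)) 0" by simp
    \<comment> \<open>The remainder formula is available on \<open>{a 0..b 0}\<close>, which carries
      the whole mass of \<open>\<sigma> 0\<close>.\<close>
    moreover have "AE x in \<sigma> 0. s * (poly (W c j) x * poly (l k) x * \<omega> c j x) =
        (cauchy_transform (\<sigma> j) x - poly (S j) x / poly (T c) x) * poly (l k) x"
      using O.AE_Icc by eventually_elim (simp add: s)
    moreover have [measurable]: "(cauchy_transform (\<sigma> j) :: real \<Rightarrow> real) \<in> borel_measurable borel"
      unfolding cauchy_transform_def of_real_eq_id id_apply
      using cm[of j] j by (intro compact_measure.borel_measurable_cauchy_integral) auto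
    have [measurable]: "\<omega> c j \<in> borel_measurable borel" using w\<omega>[OF j] by (simp add: weight_on_def)
    have "(\<lambda>x. s * (poly (W c j) x * poly (l k) x * \<omega> c j x)) \<in> borel_measurable (\<sigma> 0)"
      "(\<lambda>x. (cauchy_transform (\<sigma> j) x - poly (S j) x / poly (T c) x) * poly (l k) x) \<in> borel_measurable (\<sigma> 0)"
      unfolding O.measurable_eq by measurable
    ultimately show ?thesis
      using has_bochner_integral_cong_AE by blast
  qed
  moreover have "AE x in \<sigma> 0. poly (T c) x \<noteq> 0"
    using O.AE_Icc by eventually_elim (rule T_nz)
  moreover have "T c \<noteq> 0" using A.coeff_mop[OF wu[of c]] by (auto simp: T_def)
  ultimately have "nonlinear_fourier_pade m (\<sigma> 0) l \<sigma> n (T c) S"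
    unfolding nonlinear_fourier_pade_def Let_def N_def[symmetric]
    using T_deg S by (simp add: d_def)
  then show ?thesis by blast
qed

end
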